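(* For every non-negative integer $k$, the value $C_k$ is a subdivision invariant: if $i\colon N\to M$ and $i'\colon N\to M'$ are subdivisions of a fixed finite simplicial complex $N$ and there is a simplicial isomorphism $M\cong M'$, then $C_k(i)=C_k(i')$.
   Context: For a finite simplicial complex, the space of simplicial $k$-chains with real coefficients is equipped with the standard inner product, for which the simplices are orthonormal. A subdivision $i\colon N\to M$ induces the injective chain map $i_*$ sending an oriented simplex of $N$ to the sum of the compatibly oriented simplices of $M$ of the same dimension subdividing it. Subspaces $V_k$ of the $k$-chains of $M$ are defined by downward recursion: $V_{top}=(\operatorname{im} i_* )^\perp$ in the top dimension and $V_k=(\operatorname{im} i_*\oplus\partial V_{k+1})^\perp$, complements taken in the standard inner product in degree $k$. For subspaces $X,Y$ of an inner product space put $\langle X,Y\rangle=\max\{(x,y):x\in X,\ y\in Y,\ |x|=|y|=1\}$ (taken to be $0$ if one of the subspaces is zero). Then $$C_k=C_k(i)=\langle \operatorname{im} i_*,\partial V_{k+1}\rangle,$$ where $\operatorname{im} i_*$ is in degree $k$. Two subdivisions $M,M'$ of $N$ are called isomorphic if there is a simplicial isomorphism between them. A (real-valued) subdivision invariant is an assignment $f$ of real numbers to subdivisions of $N$ such that $M\cong M'$ implies $f(M)=f(M')$.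
   Formalization: The simplicial isomorphism M≅M' must also carry the simplices of M lying in each simplex of N to those of M' lying in its image under some automorphism of N; without this the claim fails: a 2-edge path subdivided 3+1 and 2+2 gives C_0² = 1/2 and 3/7. *)

theory Defs
  imports
    "HOL-Analysis.Polytope"
    "HOL-Combinatorics.Permutations"
    "Jordan_Normal_Form.Determinant"
begin

text \<open>
  Finite simplicial complexes are geometric, as in \<open>simplicial_complex\<close> of \<open>HOL-Analysis.Polytope\<close>:
  finite sets of simplices in a Euclidean space (the empty simplex is allowed as a member).
\<close>

definition subdivision :: "'a::euclidean_space set set \<Rightarrow> 'a set set \<Rightarrow> bool" where
  "subdivision N M \<longleftrightarrow>
     simplicial_complex N \<and> simplicial_complex M \<and> \<Union>M = \<Union>N \<and> (\<forall>S\<in>M. \<exists>T\<in>N. S \<subseteq> T)"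

definition vertex_sets :: "'a::euclidean_space set set \<Rightarrow> 'a set set" where
  "vertex_sets K = {V. \<not> affine_dependent V \<and> convex hull V \<in> K}"

definition simplicial_iso ::
    "'a::euclidean_space set set \<Rightarrow> 'a set set \<Rightarrow> ('a \<Rightarrow> 'a) \<Rightarrow> bool" where
  "simplicial_iso K L f \<longleftrightarrow>
     bij_betw f (\<Union>(vertex_sets K)) (\<Union>(vertex_sets L)) \<and> (`) f ` vertex_sets K = vertex_sets L"

text \<open>
  An isomorphism of the subdivisions \<open>N \<rightarrow> M\<close> and \<open>N \<rightarrow> M'\<close> is a simplicial isomorphism of \<open>M\<close> with
  \<open>M'\<close> that carries the subdivided simplices of \<open>N\<close> in \<open>M\<close> to those in \<open>M'\<close>, possibly permuting
  them by an automorphism \<open>g\<close> of \<open>N\<close>.  A simplicial isomorphism that ignores how \<open>N\<close> sits in \<open>M\<close>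
  and \<open>M'\<close> would not do: a path with two edges subdivided into \<open>3 + 1\<close> and into \<open>2 + 2\<close> edges
  gives the same path with four edges, but \<open>C_0\<close> is the square root of \<open>1/2\<close> in the first case
  and of \<open>3/7\<close> in the second.
\<close>

definition isomorphic_subdivisions ::
    "'a::euclidean_space set set \<Rightarrow> 'a set set \<Rightarrow> 'a set set \<Rightarrow> bool" where
  "isomorphic_subdivisions N M M' \<longleftrightarrow>
     (\<exists>f g. simplicial_iso M M' f \<and> simplicial_iso N N g \<and>
        (\<forall>V\<in>vertex_sets M. \<forall>W\<in>vertex_sets N.
           convex hull V \<subseteq> convex hull W \<longleftrightarrow> convex hull (f ` V) \<subseteq> convex hull (g ` W)))"

definition subdivision_invariant ::
    "'a::euclidean_space set set \<Rightarrow> ('a set set \<Rightarrow> real) \<Rightarrow> bool" where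
  "subdivision_invariant N F \<longleftrightarrow>
     (\<forall>M M'. subdivision N M \<and> subdivision N M' \<and> isomorphic_subdivisions N M M' \<longrightarrow> F M = F M')"

definition ordered_simplices :: "'a::euclidean_space set set \<Rightarrow> nat \<Rightarrow> 'a list set" where
  "ordered_simplices K k =
     {vs. length vs = Suc k \<and> distinct vs \<and> \<not> affine_dependent (set vs) \<and> convex hull (set vs) \<in> K}"

type_synonym 'a chain = "'a list \<Rightarrow> real"

text \<open>
  A chain is the function giving the coefficient of every oriented simplex, opposite orientations
  having opposite coefficients; an oriented simplex is represented by any of its orderings.
\<close>

definition chains :: "'a::euclidean_space set set \<Rightarrow> nat \<Rightarrow> 'a chain set" where
  "chains K k =
     {c. (\<forall>vs. vs \<notin> ordered_simplices K k \<longrightarrow> c vs = 0) \<and>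
         (\<forall>vs\<in>ordered_simplices K k. \<forall>p. p permutes {..<Suc k} \<longrightarrow>
            c (permute_list p vs) = of_int (sign p) * c vs)}"

text \<open>The oriented simplex \<open>[v\<^sub>0, \<dots>, v\<^sub>k]\<close> regarded as a chain.\<close>

definition oriented_simplex :: "'a list \<Rightarrow> 'a chain" where
  "oriented_simplex vs ws =
     (\<Sum>p | p permutes {..<length vs} \<and> permute_list p vs = ws. of_int (sign p))"

text \<open>
  In the next two definitions every \<open>k\<close>-simplex is counted once for each of its \<open>(k + 1)!\<close>
  orderings, and all of them contribute equally; hence the division by the factorial.  So the
  simplices, with arbitrarily chosen orientations, are orthonormal for \<open>chain_inner\<close>.
\<close>

definition chain_inner ::
    "'a::euclidean_space set set \<Rightarrow> nat \<Rightarrow> 'a chain \<Rightarrow> 'a chain \<Rightarrow> real" where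
  "chain_inner K k x y = (\<Sum>vs\<in>ordered_simplices K k. x vs * y vs) / fact (Suc k)"

definition linear_extension ::
    "'a::euclidean_space set set \<Rightarrow> nat \<Rightarrow> ('a list \<Rightarrow> 'a chain) \<Rightarrow> 'a chain \<Rightarrow> 'a chain" where
  "linear_extension K k F c =
     (\<lambda>ws. (\<Sum>vs\<in>ordered_simplices K k. c vs * F vs ws) / fact (Suc k))"

definition boundary :: "'a::euclidean_space set set \<Rightarrow> nat \<Rightarrow> 'a chain \<Rightarrow> 'a chain" where
  "boundary K k =
     linear_extension K k
       (\<lambda>vs ws. \<Sum>i\<le>k. (-1) ^ i * oriented_simplex (take i vs @ drop (Suc i) vs) ws)"

text \<open>
  For two \<open>k\<close>-simplices with the same affine hull, this is \<open>1\<close> if the orientations given by the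
  orderings are compatible and \<open>-1\<close> otherwise: the matrix expresses the edge vectors
  \<open>w\<^sub>j - w\<^sub>0\<close> in the basis \<open>v\<^sub>i - v\<^sub>0\<close>.
\<close>

definition relative_orientation :: "'a::euclidean_space list \<Rightarrow> 'a list \<Rightarrow> real" where
  "relative_orientation vs ws =
     sgn (Determinant.det (mat (length vs - 1) (length ws - 1)
       (\<lambda>(i, j). representation ((\<lambda>v. v - hd vs) ` set (tl vs))
                   (ws ! Suc j - hd ws) (vs ! Suc i - hd vs))))"

text \<open>
  Coefficient of \<open>ws\<close> in the sum of the compatibly oriented simplices of \<open>M\<close> that subdivide \<open>vs\<close>.
\<close>

definition subdivided_simplex :: "'a::euclidean_space set set \<Rightarrow> nat \<Rightarrow> 'a list \<Rightarrow> 'a chain" where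
  "subdivided_simplex M k vs ws =
     (if ws \<in> ordered_simplices M k \<and> convex hull (set ws) \<subseteq> convex hull (set vs)
      then relative_orientation vs ws else 0)"

definition subdivision_map ::
    "'a::euclidean_space set set \<Rightarrow> 'a set set \<Rightarrow> nat \<Rightarrow> 'a chain \<Rightarrow> 'a chain" where
  "subdivision_map N M k = linear_extension N k (subdivided_simplex M k)"

definition subdivision_im ::
    "'a::euclidean_space set set \<Rightarrow> 'a set set \<Rightarrow> nat \<Rightarrow> 'a chain set" where
  "subdivision_im N M k = subdivision_map N M k ` chains N k"

definition orth_complement ::
    "'a::euclidean_space set set \<Rightarrow> nat \<Rightarrow> 'a chain set \<Rightarrow> 'a chain set" where
  "orth_complement K k X = {y\<in>chains K k. \<forall>x\<in>X. chain_inner K k x y = 0}"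

text \<open>The element \<open>0\<close> only serves to give the empty complex a dimension.\<close>

definition complex_dim :: "'a::euclidean_space set set \<Rightarrow> nat" where
  "complex_dim K = nat (Max (insert 0 (aff_dim ` K)))"

text \<open>Above the top dimension there are no nonzero chains, so \<open>V_space\<close> is zero there.\<close>

function V_space :: "'a::euclidean_space set set \<Rightarrow> 'a set set \<Rightarrow> nat \<Rightarrow> 'a chain set" where
  "V_space N M k =
     (if complex_dim M \<le> k then orth_complement M k (subdivision_im N M k)
      else orth_complement M k
        {\<lambda>vs. x vs + y vs | x y.
           x \<in> subdivision_im N M k \<and> y \<in> boundary M (Suc k) ` V_space N M (Suc k)})"
  by pat_completeness auto
termination
  by (relation "measure (\<lambda>(N, M, k). complex_dim M - k)") auto

declare V_space.simps [simp del]

definition max_cosine ::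
    "'a::euclidean_space set set \<Rightarrow> nat \<Rightarrow> 'a chain set \<Rightarrow> 'a chain set \<Rightarrow> real" where
  "max_cosine K k X Y =
     (if X \<subseteq> {\<lambda>_. 0} \<or> Y \<subseteq> {\<lambda>_. 0} then 0
      else GREATEST r. \<exists>x\<in>X. \<exists>y\<in>Y.
        sqrt (chain_inner K k x x) = 1 \<and> sqrt (chain_inner K k y y) = 1 \<and> r = chain_inner K k x y)"

definition C_value :: "nat \<Rightarrow> 'a::euclidean_space set set \<Rightarrow> 'a set set \<Rightarrow> real" where
  "C_value k N M =
     max_cosine M k (subdivision_im N M k) (boundary M (Suc k) ` V_space N M (Suc k))"

end

theory Submission
  imports Defs
begin

text \<open>
  An isomorphism \<open>f\<close> of \<open>M\<close> with \<open>M'\<close> identifies the chains of the two complexes isometrically and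
  compatibly with the boundary, so everything reduces to showing that it identifies the images
  of the two subdivision maps.  Let \<open>\<sigma>\<close> be a simplex of \<open>N\<close> and \<open>g \<sigma>\<close> the simplex corresponding to it.
  The simplices of \<open>M\<close> subdividing \<open>\<sigma>\<close> go to those of \<open>M'\<close> subdividing \<open>g \<sigma>\<close>, and compatibly
  oriented neighbours stay so, because lying on opposite sides of a common facet is a combinatorial
  property.  As any two simplices subdividing \<open>\<sigma>\<close> are joined by a chain of such neighbours, \<open>f\<close> either
  preserves or reverses the orientation of all of them at once.  Hence \<open>f\<close> sends the image of \<open>\<sigma>\<close> to
  the image of \<open>g \<sigma>\<close> up to sign.
\<close>

section \<open>Relative orientation\<close>

text \<open>\<open>ordered_simplices\<close> without the complex, so that orientations of simplices
  from different complexes can be compared.\<close>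

definition affine_frame :: "nat \<Rightarrow> 'a::euclidean_space list \<Rightarrow> bool" where
  "affine_frame k vs \<longleftrightarrow> length vs = Suc k \<and> distinct vs \<and> \<not> affine_dependent (set vs)"

lemma affine_frame_edges:
  fixes vs :: "'a::euclidean_space list"
  assumes "affine_frame k vs"
  shows "independent ((\<lambda>v. v - hd vs) ` set (tl vs))"
    and "affine hull (set vs) = (\<lambda>x. hd vs + x) ` span ((\<lambda>v. v - hd vs) ` set (tl vs))"
    and "bij_betw (\<lambda>i. vs ! Suc i - hd vs) {..<k} ((\<lambda>v. v - hd vs) ` set (tl vs))"
proof -
  obtain a us where vs: "vs = a # us"
    using assms by (cases vs) (auto simp: affine_frame_def)
  have *: "(\<lambda>v. v - a) = (\<lambda>v. - a + v)"
    by auto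
  have a: "a \<notin> set us" "distinct us" "length us = k" "\<not> affine_dependent (insert a (set us))"
    using assms by (auto simp: affine_frame_def vs)
  show "independent ((\<lambda>v. v - hd vs) ` set (tl vs))"
    using a affine_dependent_iff_dependent[of a "set us"] by (simp add: vs *)
  show "affine hull (set vs) = (\<lambda>x. hd vs + x) ` span ((\<lambda>v. v - hd vs) ` set (tl vs))"
    using affine_hull_insert_span_gen[of a "set us"] by (simp add: vs *)
  have "bij_betw ((!) us) {..<k} (set us)"
    using bij_betw_nth[OF a(2)] a(3) by simp
  moreover have "bij_betw (\<lambda>v. v - a) (set us) ((\<lambda>v. v - a) ` set us)"
    by (rule inj_on_imp_bij_betw) (auto simp: inj_on_def)
  ultimately show "bij_betw (\<lambda>i. vs ! Suc i - hd vs) {..<k} ((\<lambda>v. v - hd vs) ` set (tl vs))"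
    using bij_betw_trans[of "(!) us"] by (fastforce simp: vs comp_def)
qed

text \<open>Differences of points of the affine hull lie in the span of the edge vectors at
  \<open>hd vs\<close>, for which these vectors form a basis.\<close>

lemma edge_coordinates:
  fixes vs ws :: "'a::euclidean_space list"
  assumes "affine_frame k vs" "length ws = Suc k" "set ws \<subseteq> affine hull (set vs)"
  obtains A :: "nat \<Rightarrow> nat \<Rightarrow> real" where
    "\<And>j. j < k \<Longrightarrow> ws ! Suc j - hd ws = (\<Sum>i<k. A i j *\<^sub>R (vs ! Suc i - hd vs))"
proof -
  let ?B = "(\<lambda>v. v - hd vs) ` set (tl vs)"
  note e = affine_frame_edges[OF assms(1)]
  have fin: "finite ?B"
    by simp
  have "ws ! Suc j - hd ws = (\<Sum>i<k. representation ?B (ws ! Suc j - hd ws) (vs ! Suc i - hd vs) *\<^sub>R (vs ! Suc i - hd vs))"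
    if "j < k" for j
  proof -
    have "ws ! Suc j \<in> set ws" "hd ws \<in> set ws"
      using that assms(2) by (auto intro!: hd_in_set)
    then obtain x y where "x \<in> span ?B" "y \<in> span ?B" "ws ! Suc j = hd vs + x" "hd ws = hd vs + y"
      using assms(3) e(2) by blast
    then have "ws ! Suc j - hd ws \<in> span ?B"
      by (metis add_diff_cancel_left span_diff)
    then have "ws ! Suc j - hd ws = (\<Sum>b\<in>?B. representation ?B (ws ! Suc j - hd ws) b *\<^sub>R b)"
      using real_vector.sum_representation_eq[OF e(1) _ fin, of "ws ! Suc j - hd ws"] by simp
    also have "\<dots> = (\<Sum>i<k. representation ?B (ws ! Suc j - hd ws) (vs ! Suc i - hd vs) *\<^sub>R (vs ! Suc i - hd vs))"
      by (rule sum.reindex_bij_betw[OF e(3), symmetric])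
    finally show ?thesis .
  qed
  then show thesis
    by (rule that)
qed

text \<open>Coordinates in the basis of edge vectors are unique, so any coefficient matrix may
  replace \<open>representation\<close>. The determinants below are computed through this.\<close>

lemma relative_orientation_eq:
  fixes vs ws :: "'a::euclidean_space list"
  assumes "affine_frame k vs" "length ws = Suc k"
    and A: "\<And>j. j < k \<Longrightarrow> ws ! Suc j - hd ws = (\<Sum>i<k. A i j *\<^sub>R (vs ! Suc i - hd vs))"
  shows "relative_orientation vs ws = sgn (Determinant.det (mat k k (\<lambda>(i, j). A i j)))"
proof -
  let ?B = "(\<lambda>v. v - hd vs) ` set (tl vs)"
  note e = affine_frame_edges[OF assms(1)]
  have mem: "vs ! Suc i - hd vs \<in> ?B" if "i < k" for i
    using e(3) that by (auto simp: bij_betw_def)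
  have inj: "vs ! Suc i - hd vs = vs ! Suc j - hd vs \<longleftrightarrow> i = j" if "i < k" "j < k" for i j
    using e(3) that by (auto simp: bij_betw_def inj_on_def)
  have "representation ?B (ws ! Suc j - hd ws) (vs ! Suc i - hd vs) = A i j" if "i < k" "j < k" for i j
  proof -
    have "representation ?B (ws ! Suc j - hd ws) (vs ! Suc i - hd vs)
        = (\<Sum>l<k. representation ?B (A l j *\<^sub>R (vs ! Suc l - hd vs)) (vs ! Suc i - hd vs))"
      unfolding A[OF that(2)]
      by (subst real_vector.representation_sum[OF e(1)]) (auto intro: span_scale[OF span_base[OF mem]])
    also have "\<dots> = (\<Sum>l<k. if l = i then A l j else 0)"
    proof (rule sum.cong)
      fix l assume "l \<in> {..<k}"
      then show "representation ?B (A l j *\<^sub>R (vs ! Suc l - hd vs)) (vs ! Suc i - hd vs)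
          = (if l = i then A l j else 0)"
        using inj[of l i] that
        by (subst real_vector.representation_scale[OF e(1)])
          (auto intro!: span_base mem simp: real_vector.representation_basis[OF e(1) mem])
    qed simp
    finally show ?thesis
      using that by simp
  qed
  then have "mat k k (\<lambda>(i, j). representation ?B (ws ! Suc j - hd ws) (vs ! Suc i - hd vs))
      = mat k k (\<lambda>(i, j). A i j)"
    by (intro eq_matI) auto
  moreover have "length vs - 1 = k" "length ws - 1 = k"
    using assms by (auto simp: affine_frame_def)
  ultimately show ?thesis
    by (simp add: relative_orientation_def)
qed

text \<open>Change-of-basis matrices multiply, and so do the signs of their determinants.\<close>

lemma relative_orientation_trans:
  fixes us vs ws :: "'a::euclidean_space list"
  assumes "affine_frame k us" "affine_frame k vs" "length ws = Suc k"
    and "set vs \<subseteq> affine hull (set us)" "set ws \<subseteq> affine hull (set vs)"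
  shows "relative_orientation us ws = relative_orientation us vs * relative_orientation vs ws"
proof -
  have len: "length vs = Suc k"
    using assms by (auto simp: affine_frame_def)
  obtain A where A: "\<And>j. j < k \<Longrightarrow> vs ! Suc j - hd vs = (\<Sum>i<k. A i j *\<^sub>R (us ! Suc i - hd us))"
    using edge_coordinates[OF assms(1) len assms(4)] by blast
  obtain B where B: "\<And>j. j < k \<Longrightarrow> ws ! Suc j - hd ws = (\<Sum>i<k. B i j *\<^sub>R (vs ! Suc i - hd vs))"
    using edge_coordinates[OF assms(2,3,5)] by blast
  have C: "ws ! Suc j - hd ws = (\<Sum>i<k. (\<Sum>l<k. A i l * B l j) *\<^sub>R (us ! Suc i - hd us))" if "j < k" for j
  proof -
    have "ws ! Suc j - hd ws = (\<Sum>l<k. B l j *\<^sub>R (\<Sum>i<k. A i l *\<^sub>R (us ! Suc i - hd us)))"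
      using A B[OF that] by simp
    also have "\<dots> = (\<Sum>l<k. \<Sum>i<k. (A i l * B l j) *\<^sub>R (us ! Suc i - hd us))"
      by (simp add: scaleR_sum_right mult.commute)
    also have "\<dots> = (\<Sum>i<k. \<Sum>l<k. (A i l * B l j) *\<^sub>R (us ! Suc i - hd us))"
      by (rule sum.swap)
    finally show ?thesis
      by (simp add: scaleR_sum_left)
  qed
  have "mat k k (\<lambda>(i, j). \<Sum>l<k. A i l * B l j) = mat k k (\<lambda>(i, j). A i j) * mat k k (\<lambda>(i, j). B i j)"
    by (intro eq_matI) (auto simp: scalar_prod_def lessThan_atLeast0)
  then show ?thesis
    using relative_orientation_eq[OF assms(1,3) C] relative_orientation_eq[OF assms(1) len A]
      relative_orientation_eq[OF assms(2,3) B]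
    by (simp add: Determinant.det_mult[of _ k] sgn_mult)
qed

lemma relative_orientation_self:
  assumes "affine_frame k vs"
  shows "relative_orientation vs vs = 1"
proof -
  have len: "length vs = Suc k"
    using assms by (auto simp: affine_frame_def)
  have "vs ! Suc j - hd vs = (\<Sum>i<k. (if i = j then 1 else 0) *\<^sub>R (vs ! Suc i - hd vs))" if "j < k" for j
    using that by (simp add: if_distrib[of "\<lambda>x. x *\<^sub>R _"] cong: if_cong)
  from relative_orientation_eq[OF assms len this]
  have "relative_orientation vs vs = sgn (Determinant.det (mat k k (\<lambda>(i, j). if i = j then 1 else 0)))" .
  also have "mat k k (\<lambda>(i, j). if i = j then 1 else (0::real)) = 1\<^sub>m k"
    by (intro eq_matI) auto
  finally show ?thesis
    by simp
qed

text \<open>The matrix expressing the permuted edge vectors depends on \<open>p\<close> alone, not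
  on the position of the vertices. Reordering therefore has the same effect before and after a
  simplicial map.\<close>

lemma relative_orientation_permute:
  fixes us vs :: "'a::euclidean_space list"
  assumes "affine_frame k vs" "affine_frame k us" "p permutes {..<Suc k}"
  shows "relative_orientation vs (permute_list p vs) = relative_orientation us (permute_list p us)"
proof -
  \<comment> \<open>Column \<open>j\<close> holds the coordinates of vertex \<open>p (Suc j)\<close>
    minus vertex \<open>p 0\<close>. Vertex \<open>0\<close> is the base point and contributes no
    coordinate.\<close>
  define A :: "nat \<Rightarrow> nat \<Rightarrow> real" where
    "A i j = of_bool (p (Suc j) = Suc i) - of_bool (p 0 = Suc i)" for i j
  have "relative_orientation ws (permute_list p ws) = sgn (Determinant.det (mat k k (\<lambda>(i, j). A i j)))"
    if ws: "affine_frame k ws" for ws :: "'a list"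
  proof (rule relative_orientation_eq[OF ws])
    show len: "length (permute_list p ws) = Suc k"
      using ws by (simp add: affine_frame_def)
    have lw: "length ws = Suc k" and pw: "p permutes {..<length ws}"
      using ws assms(3) by (auto simp: affine_frame_def)
    have hd: "hd xs = xs ! 0" if "length xs = Suc k" for xs :: "'a list"
      using that by (cases xs) auto
    have *: "(\<Sum>i<k. of_bool (l = Suc i) *\<^sub>R (ws ! Suc i - hd ws)) = ws ! l - hd ws" if "l < Suc k" for l
    proof (cases l)
      case 0
      then show ?thesis
        using lw by (simp add: hd)
    next
      case (Suc m)
      have "(\<Sum>i<k. of_bool (m = i) *\<^sub>R (ws ! Suc i - hd ws)) = (\<Sum>i<k. if i = m then ws ! Suc i - hd ws else 0)"
        by (intro sum.cong) auto
      then show ?thesis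
        using Suc that by simp
    qed
    fix j assume j: "j < k"
    have lt: "p (Suc j) < Suc k" "p 0 < Suc k"
      using permutes_in_image[OF assms(3)] j by auto
    have "permute_list p ws ! Suc j - hd (permute_list p ws) = ws ! p (Suc j) - ws ! p 0"
      using j lw len by (simp add: hd permute_list_nth[OF pw])
    also have "\<dots> = (\<Sum>i<k. A i j *\<^sub>R (ws ! Suc i - hd ws))"
      unfolding A_def scaleR_left_diff_distrib sum_subtractf
      using lt by (simp add: *)
    finally show "permute_list p ws ! Suc j - hd (permute_list p ws) = (\<Sum>i<k. A i j *\<^sub>R (ws ! Suc i - hd ws))" .
  qed
  from this[OF assms(1)] this[OF assms(2)] show ?thesis
    by simp
qed

text \<open>If \<open>u a\<close> were nonnegative, points close to the barycentre of
  \<open>X\<close> on the segment towards \<open>b\<close> would lie in both simplices, hence in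
  \<open>convex hull X\<close>. The line through such a point and the barycentre contains
  \<open>b\<close>, which would then lie in the affine hull of \<open>X\<close>.\<close>

lemma opposite_vertex_coordinate_neg:
  fixes a b :: "'a::euclidean_space"
  assumes X: "finite X" "X \<noteq> {}" "a \<notin> X" "b \<notin> X" and ind: "\<not> affine_dependent (insert b X)"
    and u: "sum u (insert a X) = 1" "(\<Sum>v\<in>insert a X. u v *\<^sub>R v) = b"
    and meet: "convex hull (insert a X) \<inter> convex hull (insert b X) \<subseteq> convex hull X"
  shows "u a < 0"
proof (rule ccontr)
  assume "\<not> u a < 0"
  then have ua: "u a \<ge> 0"
    by simp
  define n where "n = real (card X)"
  have n: "n > 0"
    using X by (simp add: n_def card_gt_0_iff)
  define m where "m = (\<Sum>v\<in>X. \<bar>u v\<bar>)"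
  have m: "\<bar>u v\<bar> \<le> m" if "v \<in> X" for v
    using X that by (auto simp: m_def sum_nonneg intro: member_le_sum)
  have m0: "m \<ge> 0"
    by (simp add: m_def sum_nonneg)
  \<comment> \<open>Chosen so that \<open>(1 - t) / n = t * (m + 1)\<close>: the weight that the
    barycentre gives to each vertex of \<open>X\<close> then outweighs \<open>t * u v\<close>,
    whatever its sign.\<close>
  define t where "t = 1 / (1 + n * (m + 1))"
  have pos: "1 + n * (m + 1) \<ge> 1"
    using n m0 by simp
  then have "t * (1 + n * (m + 1)) = 1"
    by (simp add: t_def)
  then have "1 - t = n * (t * (m + 1))"
    by (simp add: algebra_simps)
  then have t: "0 < t" "t \<le> 1" "(1 - t) / n = t * (m + 1)"
    using n pos by (auto simp: t_def)
  define c where "c = (\<Sum>v\<in>X. (1 / n) *\<^sub>R v)"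
  have c: "c \<in> convex hull X"
    unfolding c_def using X n
    by (intro convex_sum) (auto simp: n_def hull_inc)
  define q where "q = (1 - t) *\<^sub>R c + t *\<^sub>R b"
  have "q \<in> convex hull (insert b X)"
    unfolding q_def using t c hull_mono[of X "insert b X" convex]
    by (intro convexD_alt[OF convex_convex_hull]) (auto simp: hull_inc)
  moreover have "q \<in> convex hull (insert a X)"
  proof -
    \<comment> \<open>These are affine coordinates of \<open>q\<close> with respect to
      \<open>insert a X\<close>. At \<open>a\<close> only \<open>t * u a\<close> remains, as the
      barycentre has no weight there.\<close>
    define w where "w v = t * u v + (if v = a then 0 else (1 - t) / n)" for v
    have "w v \<ge> 0" if "v \<in> insert a X" for v
    proof (cases "v = a")
      case False
      then have "\<bar>u v\<bar> \<le> m"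
        using m that by auto
      then have "t * - u v \<le> t * (m + 1)"
        using t(1) by (intro mult_left_mono) auto
      then show ?thesis
        using False t(3) by (simp add: w_def)
    qed (use ua t in \<open>simp add: w_def\<close>)
    moreover have "sum w (insert a X) = 1"
    proof -
      have "sum w (insert a X) = t * sum u (insert a X) + (\<Sum>v\<in>insert a X. if v = a then 0 else (1 - t) / n)"
        unfolding w_def sum.distrib sum_distrib_left ..
      also have "(\<Sum>v\<in>insert a X. if v = a then 0 else (1 - t) / n) = (\<Sum>v\<in>X. (1 - t) / n)"
        using X by (intro sum.mono_neutral_cong_right) auto
      finally have "sum w (insert a X) = t * sum u (insert a X) + (\<Sum>v\<in>X. (1 - t) / n)" .
      then show ?thesis
        using u(1) n by (simp add: n_def)
    qed
    moreover have "(\<Sum>v\<in>insert a X. w v *\<^sub>R v) = q"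
    proof -
      have "(\<Sum>v\<in>insert a X. w v *\<^sub>R v)
          = (\<Sum>v\<in>insert a X. (t * u v) *\<^sub>R v) + (\<Sum>v\<in>insert a X. (if v = a then 0 else (1 - t) / n) *\<^sub>R v)"
        by (simp only: w_def scaleR_left_distrib sum.distrib)
      also have "(\<Sum>v\<in>insert a X. (t * u v) *\<^sub>R v) = t *\<^sub>R b"
        by (simp add: u(2)[symmetric] scaleR_sum_right)
      also have "(\<Sum>v\<in>insert a X. (if v = a then 0 else (1 - t) / n) *\<^sub>R v) = (\<Sum>v\<in>X. ((1 - t) / n) *\<^sub>R v)"
        using X by (intro sum.mono_neutral_cong_right) auto
      also have "\<dots> = (1 - t) *\<^sub>R c"
        by (simp add: c_def scaleR_sum_right)
      finally show ?thesis
        by (simp add: q_def)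
    qed
    ultimately show ?thesis
      using X(1) by (subst convex_hull_finite) auto
  qed
  ultimately have "q \<in> affine hull X"
    using meet convex_hull_subset_affine_hull by blast
  moreover have "c \<in> affine hull X"
    using c convex_hull_subset_affine_hull by blast
  ultimately have "(1 - 1 / t) *\<^sub>R c + (1 / t) *\<^sub>R q \<in> affine hull X"
    by (intro mem_affine) auto
  also have "(1 - 1 / t) *\<^sub>R c + (1 / t) *\<^sub>R q = b"
    using t(1) by (simp add: q_def algebra_simps)
  finally show False
    using ind X(4) by (auto simp: affine_dependent_def)
qed

text \<open>With the common facet listed first, the coordinate matrix differs from the identity only
  in its last column. It is upper triangular with determinant \<open>u a\<close>, which is negative
  because \<open>a\<close> and \<open>b\<close> lie on opposite sides of the facet.\<close>

lemma relative_orientation_adjacent: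
  fixes xs :: "'a::euclidean_space list"
  assumes xs: "xs \<noteq> []" and a: "affine_frame k (xs @ [a])" and b: "affine_frame k (xs @ [b])"
    and aff: "b \<in> affine hull (set (xs @ [a]))"
    and meet: "convex hull (insert a (set xs)) \<inter> convex hull (insert b (set xs)) \<subseteq> convex hull (set xs)"
  shows "relative_orientation (xs @ [a]) (xs @ [b]) = -1"
proof -
  let ?vs = "xs @ [a]"
  let ?ws = "xs @ [b]"
  have len: "length xs = k"
    using a by (simp add: affine_frame_def)
  then obtain m where k: "k = Suc m"
    using xs by (cases k) auto
  have hd: "hd ?vs = ?vs ! 0" "hd ?ws = ?ws ! 0" "?ws ! 0 = ?vs ! 0"
    using xs by (auto simp: hd_conv_nth nth_append)
  obtain u where u: "sum u (insert a (set xs)) = 1" "(\<Sum>v\<in>insert a (set xs). u v *\<^sub>R v) = b"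
    using aff by (auto simp: affine_hull_finite)
  have neg: "u a < 0"
    by (rule opposite_vertex_coordinate_neg[OF _ _ _ _ _ u meet])
      (use a b xs in \<open>auto simp: affine_frame_def\<close>)
  \<comment> \<open>The edges within \<open>xs\<close> are shared and give unit columns. The last
    column lists the affine coordinates of \<open>b\<close>, without that of the base
    vertex.\<close>
  define A :: "nat \<Rightarrow> nat \<Rightarrow> real" where
    "A i j = (if j = m then u (?vs ! Suc i) else of_bool (i = j))" for i j
  have "?ws ! Suc j - hd ?ws = (\<Sum>i<k. A i j *\<^sub>R (?vs ! Suc i - hd ?vs))" if "j < k" for j
  proof (cases "j = m")
    case True
    have bij: "bij_betw ((!) ?vs) {..<Suc k} (insert a (set xs))"
      using bij_betw_nth[of ?vs] a by (auto simp: affine_frame_def)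
    \<comment> \<open>The coefficients sum to \<open>1\<close>, so subtracting the base vertex turns
      the affine combination into a linear combination of edge vectors.\<close>
    have "b - hd ?vs = (\<Sum>v\<in>insert a (set xs). u v *\<^sub>R v) - (\<Sum>v\<in>insert a (set xs). u v) *\<^sub>R hd ?vs"
      by (simp only: u scaleR_one)
    also have "\<dots> = (\<Sum>v\<in>insert a (set xs). u v *\<^sub>R (v - hd ?vs))"
      by (simp only: scaleR_sum_left scaleR_diff_right sum_subtractf)
    also have "\<dots> = (\<Sum>i<Suc k. u (?vs ! i) *\<^sub>R (?vs ! i - hd ?vs))"
      by (rule sum.reindex_bij_betw[OF bij, symmetric])
    also have "\<dots> = (\<Sum>i<k. u (?vs ! Suc i) *\<^sub>R (?vs ! Suc i - hd ?vs))"
      by (subst sum.lessThan_Suc_shift) (simp add: hd)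
    finally show ?thesis
      using True k len hd by (simp add: A_def nth_append)
  next
    case False
    have "(\<Sum>i<k. A i j *\<^sub>R (?vs ! Suc i - hd ?vs)) = (\<Sum>i<k. if i = j then ?vs ! Suc i - hd ?vs else 0)"
      using False by (intro sum.cong) (auto simp: A_def)
    also have "\<dots> = ?vs ! Suc j - hd ?vs"
      using that by simp
    finally show ?thesis
      using False that k len hd by (simp add: nth_append)
  qed
  then have "relative_orientation ?vs ?ws = sgn (Determinant.det (mat k k (\<lambda>(i, j). A i j)))"
    using b by (intro relative_orientation_eq[OF a]) (auto simp: affine_frame_def)
  also have "Determinant.det (mat k k (\<lambda>(i, j). A i j)) = prod_list (diag_mat (mat k k (\<lambda>(i, j). A i j)))"
    by (rule det_upper_triangular[of _ k]) (auto simp: A_def k)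
  also have "\<dots> = (\<Prod>i<k. A i i)"
    by (simp add: prod_list_diag_prod lessThan_atLeast0)
  also have "\<dots> = u a"
    using len by (simp add: k A_def nth_append)
  finally show ?thesis
    using neg by simp
qed

section \<open>The simplices subdividing a simplex\<close>

text \<open>A segment joining a point outside one of the affine sets to a point outside the others meets
  each of them at most once.\<close>

lemma convex_subset_Union_affine:
  fixes C :: "'a::euclidean_space set"
  assumes "finite \<A>" "\<And>A. A \<in> \<A> \<Longrightarrow> affine A" "convex C" "C \<noteq> {}" "C \<subseteq> \<Union>\<A>"
  shows "\<exists>A\<in>\<A>. C \<subseteq> A"
  using assms
proof (induction \<A> rule: finite_induct)
  case (insert A \<A>)
  show ?case
  proof (rule ccontr)
    assume none: "\<not> ?thesis"
    then obtain p where p: "p \<in> C" "p \<notin> A"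
      by auto
    \<comment> \<open>By the induction hypothesis the remaining sets alone cannot cover
      \<open>C\<close>.\<close>
    obtain q where q: "q \<in> C" "q \<notin> \<Union>\<A>"
      using insert none by blast
    define f where "f t = (1 - t) *\<^sub>R p + t *\<^sub>R q" for t :: real
    have f01: "f 0 = p" "f 1 = q"
      by (auto simp: f_def)
    have "finite {t. f t \<in> B}" if B: "B \<in> insert A \<A>" for B
    proof -
      have comb: "(1 - l) *\<^sub>R f s + l *\<^sub>R f t = f (s + l * (t - s))" for l s t
        by (simp add: f_def algebra_simps)
      \<comment> \<open>Two parameters with values in \<open>B\<close> would put the whole line,
        including \<open>p\<close> and \<open>q\<close>, into \<open>B\<close>; but \<open>A\<close>
        misses \<open>p\<close> and the other sets miss \<open>q\<close>.\<close>
      have "s = t" if "f s \<in> B" "f t \<in> B" for s t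
      proof (rule ccontr)
        assume "s \<noteq> t"
        have "f r \<in> B" for r
        proof -
          have "(1 - (r - s) / (t - s)) *\<^sub>R f s + ((r - s) / (t - s)) *\<^sub>R f t \<in> B"
            using that B insert.prems(1) by (intro mem_affine) auto
          also have "(1 - (r - s) / (t - s)) *\<^sub>R f s + ((r - s) / (t - s)) *\<^sub>R f t
              = f (s + (r - s) / (t - s) * (t - s))"
            by (rule comb)
          also have "\<dots> = f r"
            using \<open>s \<noteq> t\<close> by simp
          finally show ?thesis .
        qed
        then have "p \<in> B" "q \<in> B"
          using f01 by metis+
        then show False
          using p q B by auto
      qed
      then show ?thesis
        using finite_subset[of "{t. f t \<in> B}" "{SOME t. f t \<in> B}"] by (auto intro: someI2)
    qed
    then have "finite (\<Union>B\<in>insert A \<A>. {t. f t \<in> B})"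
      using insert.hyps(1) by (intro finite_UN_I) auto
    moreover have "{0..1} \<subseteq> (\<Union>B\<in>insert A \<A>. {t. f t \<in> B})"
    proof
      fix t :: real assume "t \<in> {0..1}"
      then have "f t \<in> C"
        unfolding f_def using p q insert.prems(2) by (intro convexD_alt) auto
      then show "t \<in> (\<Union>B\<in>insert A \<A>. {t. f t \<in> B})"
        using insert.prems(4) by auto
    qed
    ultimately have "finite {0..1::real}"
      using finite_subset by blast
    then show False
      by (simp add: infinite_Icc)
  qed
qed auto

corollary convex_subset_Union_affine_hull:
  fixes C :: "'a::euclidean_space set"
  assumes "finite I" "convex C" "C \<noteq> {}" "C \<subseteq> (\<Union>i\<in>I. affine hull (f i))"
  obtains i where "i \<in> I" "C \<subseteq> affine hull (f i)"
proof -
  have "\<exists>A\<in>(\<lambda>i. affine hull (f i)) ` I. C \<subseteq> A"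
    by (rule convex_subset_Union_affine) (use assms in auto)
  then show thesis
    using that by blast
qed

text \<open>An affinely independent set is recovered from its convex hull as the set of extreme
  points, so vertex sets inject into the finite set \<open>K\<close>.\<close>

lemma finite_vertex_sets:
  assumes "simplicial_complex K"
  shows "finite (vertex_sets K)"
proof -
  have "inj_on ((hull) convex) (vertex_sets K)"
    by (rule inj_onI)
      (metis (mono_tags, lifting) extreme_point_of_convex_hull_affine_independent mem_Collect_eq subsetI
        subset_antisym vertex_sets_def)
  moreover have "(hull) convex ` vertex_sets K \<subseteq> K"
    by (auto simp: vertex_sets_def)
  ultimately show ?thesis
    using assms finite_subset finite_imageD by (metis simplicial_complex_def)
qed

lemma vertex_sets_subset:
  assumes "simplicial_complex K" "V \<in> vertex_sets K" "U \<subseteq> V"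
  shows "U \<in> vertex_sets K"
proof -
  have "convex hull U face_of convex hull V"
    using assms face_of_convex_hull_affine_independent[of V] by (auto simp: vertex_sets_def)
  then show ?thesis
    using assms affine_independent_subset[of V U] by (auto simp: vertex_sets_def simplicial_complex_def)
qed

lemma vertex_setsE:
  assumes "simplicial_complex K" "S \<in> K"
  obtains V where "V \<in> vertex_sets K" "S = convex hull V"
  using assms by (auto simp: simplicial_complex_def simplex_def vertex_sets_def)

text \<open>The intersection is a common face, spanned by some \<open>A\<close> in \<open>U\<close>
  and some \<open>B\<close> in \<open>V\<close>. Both are its set of extreme points, so they agree
  and lie in \<open>U \<inter> V\<close>.\<close>

lemma vertex_sets_Int:
  assumes "simplicial_complex K" "U \<in> vertex_sets K" "V \<in> vertex_sets K"
  shows "convex hull U \<inter> convex hull V = convex hull (U \<inter> V)"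
proof -
  let ?F = "convex hull U \<inter> convex hull V"
  have ind: "\<not> affine_dependent U" "\<not> affine_dependent V"
    using assms by (auto simp: vertex_sets_def)
  have "?F face_of convex hull U" "?F face_of convex hull V"
    using assms by (auto simp: simplicial_complex_def vertex_sets_def) (metis Int_commute)
  then obtain A B where AB: "A \<subseteq> U" "?F = convex hull A" "B \<subseteq> V" "?F = convex hull B"
    by (auto simp: face_of_convex_hull_affine_independent ind)
  moreover have "\<not> affine_dependent A" "\<not> affine_dependent B"
    using affine_independent_subset[OF ind(1) AB(1)] affine_independent_subset[OF ind(2) AB(3)] by auto
  ultimately have "A = B"
    by (metis extreme_point_of_convex_hull_affine_independent subsetI subset_antisym)
  then have "?F \<subseteq> convex hull (U \<inter> V)"
    using AB hull_mono[of A "U \<inter> V" convex] by auto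
  moreover have "convex hull (U \<inter> V) \<subseteq> ?F"
    by (simp add: hull_mono)
  ultimately show ?thesis
    by blast
qed

lemma aff_dim_vertex_set:
  assumes "V \<in> vertex_sets K"
  shows "aff_dim V = int (card V) - 1" and "finite V"
  using assms affine_independent_iff_card by (auto simp: vertex_sets_def)

text \<open>The smallest simplex of a subdivision containing a point lies in every simplex of the
  original complex that contains the point.\<close>

lemma subdivision_carrier:
  assumes "subdivision N M" "W \<in> vertex_sets N" "q \<in> convex hull W"
  obtains V where "V \<in> vertex_sets M" "q \<in> convex hull V" "convex hull V \<subseteq> convex hull W"
proof -
  have N: "simplicial_complex N" and M: "simplicial_complex M" and W: "convex hull W \<in> N"
    using assms by (auto simp: subdivision_def vertex_sets_def)
  have "q \<in> \<Union>M"
    using assms W by (metis UnionI subdivision_def)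
  then obtain S where "S \<in> M" "q \<in> S"
    by blast
  then obtain C where C: "C \<in> vertex_sets M" "q \<in> convex hull C"
    using vertex_setsE[OF M] by metis
  obtain u where u: "\<forall>x\<in>C. 0 \<le> u x" "sum u C = 1" "(\<Sum>x\<in>C. u x *\<^sub>R x) = q"
    using C aff_dim_vertex_set(2)[OF C(1)] by (auto simp: convex_hull_finite)
  \<comment> \<open>Keeping only the vertices with positive coefficients puts \<open>q\<close> into
    the relative interior of \<open>convex hull D\<close>.\<close>
  define D where "D = {x \<in> C. u x > 0}"
  have D: "D \<subseteq> C" "D \<in> vertex_sets M"
    using vertex_sets_subset[OF M C(1), of D] by (auto simp: D_def)
  have "u x = 0" if "x \<in> C - D" for x
    using that u(1) by (force simp: D_def)
  then have "sum u D = sum u C" "(\<Sum>x\<in>D. u x *\<^sub>R x) = (\<Sum>x\<in>C. u x *\<^sub>R x)"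
    using aff_dim_vertex_set(2)[OF C(1)] D(1) by (auto intro!: sum.mono_neutral_left)
  then have "\<exists>w. (\<forall>x\<in>D. 0 < w x) \<and> sum w D = 1 \<and> (\<Sum>x\<in>D. w x *\<^sub>R x) = q"
    using u by (intro exI[of _ u]) (auto simp: D_def)
  then have q: "q \<in> rel_interior (convex hull D)"
    using D(2) rel_interior_convex_hull_explicit[of D] by (auto simp: vertex_sets_def)
  obtain T where T: "T \<in> N" "convex hull D \<subseteq> T"
    using assms D(2) by (auto simp: subdivision_def vertex_sets_def)
  have "T \<inter> convex hull W face_of T"
    using N T W by (auto simp: simplicial_complex_def)
  moreover have "q \<in> T \<inter> convex hull W"
    using q T assms(3) rel_interior_subset by blast
  \<comment> \<open>A face of \<open>T\<close> that meets the relative interior of a convex subset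
    of \<open>T\<close> contains that subset.\<close>
  ultimately have "convex hull D \<subseteq> T \<inter> convex hull W"
    using subset_of_face_of[of "T \<inter> convex hull W" T "convex hull D"] q T(2) by blast
  then show thesis
    using that[OF D(2)] q rel_interior_subset by blast
qed

section \<open>Covering and connectedness by top-dimensional simplices\<close>

definition top_simplices :: "'a::euclidean_space set set \<Rightarrow> nat \<Rightarrow> 'a set \<Rightarrow> 'a set set" where
  "top_simplices M k W = {V \<in> vertex_sets M. card V = Suc k \<and> convex hull V \<subseteq> convex hull W}"

text \<open>The union is closed, so a missed point would have a neighbourhood in
  \<open>convex hull W\<close> that is missed too. This neighbourhood has dimension \<open>k\<close>
  but would be covered by finitely many simplices of smaller dimension.\<close>

lemma top_simplices_cover:
  assumes "subdivision N M" "W \<in> vertex_sets N" "card W = Suc k"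
  shows "convex hull W \<subseteq> (\<Union>V\<in>top_simplices M k W. convex hull V)" (is "_ \<subseteq> ?U")
proof (rule ccontr)
  assume "\<not> ?thesis"
  then obtain p where p: "p \<in> convex hull W" "p \<notin> ?U"
    by auto
  have M: "simplicial_complex M"
    using assms by (auto simp: subdivision_def)
  have "closed ?U"
    using finite_vertex_sets[OF M]
    by (intro closed_UN) (auto simp: top_simplices_def intro!: compact_imp_closed finite_imp_compact_convex_hull aff_dim_vertex_set)
  then have op: "open (- ?U)"
    by (rule open_Compl)
  obtain e where e: "e > 0" "ball p e \<subseteq> - ?U"
    using op p(2) by (meson ComplI openE)
  let ?D = "convex hull W \<inter> ball p e"
  have ne: "?D \<noteq> {}"
    using p e by auto
  have dim: "aff_dim ?D = int k"
    using aff_dim_convex_Int_open[OF convex_convex_hull open_ball ne] aff_dim_vertex_set(1)[OF assms(2)] assms(3)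
    by (simp add: aff_dim_convex_hull)
  let ?L = "{V \<in> vertex_sets M. card V \<le> k}"
  have sub: "?D \<subseteq> (\<Union>V\<in>?L. affine hull V)"
  proof
    fix q assume q: "q \<in> ?D"
    then obtain V where V: "V \<in> vertex_sets M" "q \<in> convex hull V" "convex hull V \<subseteq> convex hull W"
      using subdivision_carrier[OF assms(1,2)] by blast
    have "card V \<noteq> Suc k"
      using V q e by (auto simp: top_simplices_def)
    moreover have "card V \<le> Suc k"
      using aff_dim_subset[OF V(3)] aff_dim_vertex_set(1)[OF V(1)] aff_dim_vertex_set(1)[OF assms(2)] assms(3)
      by (simp add: aff_dim_convex_hull)
    ultimately show "q \<in> (\<Union>V\<in>?L. affine hull V)"
      using V convex_hull_subset_affine_hull by fastforce
  qed
  obtain V where "V \<in> ?L" and V: "?D \<subseteq> affine hull V"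
    by (rule convex_subset_Union_affine_hull[OF _ _ ne sub])
      (use finite_vertex_sets[OF M] in \<open>auto simp: convex_Int\<close>)
  then show False
    using aff_dim_subset[OF V] dim aff_dim_vertex_set(1)[of V M] by simp
qed

text \<open>Nested affine hulls of equal dimension coincide.\<close>

lemma top_simplices_affine_hull:
  assumes "W \<in> vertex_sets N" "card W = Suc k" "V \<in> top_simplices M k W"
  shows "affine hull V = affine hull W"
proof -
  have "V \<subseteq> convex hull W"
    using assms(3) hull_subset[of V convex] by (auto simp: top_simplices_def)
  then have "affine hull V \<subseteq> affine hull W"
    by (metis affine_hull_convex_hull hull_mono)
  moreover have "aff_dim V = aff_dim W"
    using assms aff_dim_vertex_set(1)[of W N] aff_dim_vertex_set(1)[of V M]
    by (simp add: top_simplices_def)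
  ultimately show ?thesis
    by (metis aff_dim_affine_hull aff_dim_eq_full_gen hull_hull)
qed

text \<open>A segment in general position between two top-dimensional simplices avoids all faces of
  codimension at least two.  Where it passes from a simplex with \<open>P\<close> to one without, it therefore
  crosses a common facet.\<close>

lemma top_simplices_strongly_connected:
  assumes sub: "subdivision N M" and W: "W \<in> vertex_sets N" "card W = Suc k"
    and adj: "\<And>U V. \<lbrakk>U \<in> top_simplices M k W; V \<in> top_simplices M k W; card (U \<inter> V) = k; 0 < k\<rbrakk>
      \<Longrightarrow> P U \<longleftrightarrow> P V"
    and UV: "U \<in> top_simplices M k W" "V \<in> top_simplices M k W"
  shows "P U \<longleftrightarrow> P V"
proof -
  have M: "simplicial_complex M"
    using sub by (auto simp: subdivision_def)
  have False if U: "U \<in> top_simplices M k W" "P U" and V: "V \<in> top_simplices M k W" "\<not> P V" for U V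
  proof -
    let ?L = "{X \<in> vertex_sets M. card X < k}"
    have finL: "finite ?L"
      using finite_vertex_sets[OF M] by auto
    have dim: "aff_dim (convex hull S) = int k" "convex hull S \<noteq> {}" if "S \<in> top_simplices M k W" for S
      using that aff_dim_vertex_set(1)[of S M] by (auto simp: top_simplices_def aff_dim_convex_hull)
    \<comment> \<open>Fewer than \<open>k\<close> vertices span dimension below
      \<open>k - 1\<close>, so finitely many such affine hulls cannot cover a
      \<open>k\<close>-dimensional simplex.\<close>
    obtain x where x: "x \<in> convex hull U" "\<And>X. X \<in> ?L \<Longrightarrow> x \<notin> affine hull X"
    proof (rule ccontr)
      assume "\<not> thesis"
      then have *: "convex hull U \<subseteq> (\<Union>X\<in>?L. affine hull X)"
        using that by blast
      obtain X where X: "X \<in> ?L" "convex hull U \<subseteq> affine hull X"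
        by (rule convex_subset_Union_affine_hull[OF finL convex_convex_hull dim(2)[OF U(1)] *])
      then show False
        using aff_dim_subset[OF X(2)] dim[OF U(1)] aff_dim_vertex_set(1)[of X M] by simp
    qed
    \<comment> \<open>Adding \<open>x\<close> raises these dimensions by at most one, which still
      leaves them below \<open>k\<close>.\<close>
    obtain y where y: "y \<in> convex hull V" "\<And>X. X \<in> ?L \<Longrightarrow> y \<notin> affine hull (insert x X)"
    proof (rule ccontr)
      assume "\<not> thesis"
      then have *: "convex hull V \<subseteq> (\<Union>X\<in>?L. affine hull (insert x X))"
        using that by blast
      obtain X where X: "X \<in> ?L" "convex hull V \<subseteq> affine hull (insert x X)"
        by (rule convex_subset_Union_affine_hull[OF finL convex_convex_hull dim(2)[OF V(1)] *])
      then show False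
        using aff_dim_subset[OF X(2)] dim[OF V(1)] aff_dim_vertex_set(1)[of X M]
        by (simp add: aff_dim_insert split: if_splits)
    qed
    let ?seg = "closed_segment x y"
    have avoid: "q \<notin> convex hull X" if "q \<in> ?seg" "X \<in> ?L" for q X
    proof
      assume q: "q \<in> convex hull X"
      have "\<exists>t. 0 \<le> t \<and> t \<le> 1 \<and> q = (1 - t) *\<^sub>R x + t *\<^sub>R y"
        using that(1) by (simp only: in_segment(1))
      then obtain t where t: "q = (1 - t) *\<^sub>R x + t *\<^sub>R y"
        by (elim exE conjE)
      have "t \<noteq> 0"
      proof
        assume "t = 0"
        then have "x \<in> convex hull X"
          using t q by simp
        then show False
          using x(2)[OF that(2)] convex_hull_subset_affine_hull[of X] by blast
      qed
      have "q \<in> affine hull (insert x X)" "x \<in> affine hull (insert x X)"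
        using q convex_hull_subset_affine_hull[of X] hull_mono[of X "insert x X" affine] by (blast intro: hull_inc)+
      \<comment> \<open>\<open>y\<close> lies on the line through \<open>x\<close> and
        \<open>q\<close>, since \<open>t \<noteq> 0\<close>.\<close>
      then have "(1 - 1 / t) *\<^sub>R x + (1 / t) *\<^sub>R q \<in> affine hull (insert x X)"
        by (intro mem_affine) auto
      also have "(1 - 1 / t) *\<^sub>R x + (1 / t) *\<^sub>R q = y"
        using \<open>t \<noteq> 0\<close> by (simp add: t algebra_simps)
      finally show False
        using y(2)[OF that(2)] by blast
    qed
    define E where "E Q = (\<Union>S\<in>{S \<in> top_simplices M k W. Q S}. convex hull S)" for Q
    have closed: "closed (E Q)" for Q
      unfolding E_def using finite_vertex_sets[OF M]
      by (intro closed_UN) (auto simp: top_simplices_def intro!: compact_imp_closed finite_imp_compact_convex_hull aff_dim_vertex_set)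
    have "?seg \<subseteq> convex hull W"
      using x(1) y(1) U V by (intro closed_segment_subset) (auto simp: top_simplices_def)
    also have "\<dots> \<subseteq> E P \<union> E (\<lambda>S. \<not> P S)"
      using top_simplices_cover[OF sub W] by (auto simp: E_def)
    finally have "?seg \<subseteq> E P \<union> E (\<lambda>S. \<not> P S)" .
    moreover have "x \<in> E P \<inter> ?seg" "y \<in> E (\<lambda>S. \<not> P S) \<inter> ?seg"
      using x(1) y(1) U V by (auto simp: E_def)
    moreover have "connected ?seg"
      by simp
    \<comment> \<open>The two closed unions cover the connected segment and both meet it, so
      somewhere on it a simplex with \<open>P\<close> touches one without.\<close>
    ultimately have "E P \<inter> E (\<lambda>S. \<not> P S) \<inter> ?seg \<noteq> {}"
      using closed unfolding connected_closed by blast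
    then obtain q S T where q: "q \<in> ?seg" "q \<in> convex hull S" "q \<in> convex hull T"
      and S: "S \<in> top_simplices M k W" "P S" and T: "T \<in> top_simplices M k W" "\<not> P T"
      by (auto simp: E_def)
    have mem: "S \<in> vertex_sets M" "T \<in> vertex_sets M" "card S = Suc k" "card T = Suc k"
      using S T by (auto simp: top_simplices_def)
    then have fin: "finite S" "finite T"
      using aff_dim_vertex_set(2) by blast+
    have qST: "q \<in> convex hull (S \<inter> T)"
      using q vertex_sets_Int[OF M mem(1,2)] by blast
    then have "\<not> card (S \<inter> T) < k"
      using avoid[OF q(1)] vertex_sets_subset[OF M mem(1), of "S \<inter> T"] by auto
    moreover have "S \<inter> T \<noteq> S"
      using S T mem fin by (metis card_subset_eq inf.orderI inf_commute inf_le1)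
    then have "card (S \<inter> T) < Suc k"
      using mem(3) fin psubset_card_mono[of S "S \<inter> T"] by auto
    \<comment> \<open>This excludes \<open>k = 0\<close>, a case in which \<open>adj\<close> says
      nothing.\<close>
    moreover have "S \<inter> T \<noteq> {}"
      using qST by auto
    then have "card (S \<inter> T) > 0"
      using fin by (simp add: card_gt_0_iff)
    ultimately have "card (S \<inter> T) = k" "0 < k"
      by auto
    then show False
      using adj[OF S(1) T(1)] S(2) T(2) by blast
  qed
  then show ?thesis
    using UV by blast
qed

text \<open>Multiplied by the relative orientation in the other direction it gives that of
  \<open>vs\<close> with itself, which is \<open>1\<close>; hence it is not zero.\<close>

lemma relative_orientation_sign:
  fixes vs ws :: "'a::euclidean_space list"
  assumes "affine_frame k vs" "affine_frame k ws" "affine hull (set vs) = affine hull (set ws)"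
  shows "relative_orientation vs ws = 1 \<or> relative_orientation vs ws = -1"
proof -
  have "set vs \<subseteq> affine hull (set ws)" "set ws \<subseteq> affine hull (set vs)" "length vs = Suc k"
    using assms hull_subset[of "set vs" affine] hull_subset[of "set ws" affine]
    by (auto simp: affine_frame_def)
  then have "relative_orientation vs ws * relative_orientation ws vs = 1"
    using relative_orientation_trans[OF assms(1,2), of vs] relative_orientation_self[OF assms(1)] by simp
  then have "relative_orientation vs ws \<noteq> 0"
    by auto
  then show ?thesis
    by (auto simp: relative_orientation_def sgn_if split: if_splits)
qed

lemma ordered_simplices_iff:
  "vs \<in> ordered_simplices K k \<longleftrightarrow> affine_frame k vs \<and> set vs \<in> vertex_sets K"
  by (auto simp: ordered_simplices_def affine_frame_def vertex_sets_def)

text \<open>In a complex, two simplices with a common facet and different remaining vertices meet in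
  this facet only, so they lie on opposite sides of it.\<close>

lemma relative_orientation_adjacent_simplices:
  assumes M: "simplicial_complex M" and xs: "xs \<noteq> []" "a \<noteq> b"
    and a: "xs @ [a] \<in> ordered_simplices M k" and b: "xs @ [b] \<in> ordered_simplices M k"
    and aff: "affine hull (set (xs @ [a])) = affine hull (set (xs @ [b]))"
  shows "relative_orientation (xs @ [a]) (xs @ [b]) = -1"
proof (rule relative_orientation_adjacent[OF xs(1)])
  show "affine_frame k (xs @ [a])" "affine_frame k (xs @ [b])"
    using a b by (auto simp: ordered_simplices_iff)
  show "b \<in> affine hull (set (xs @ [a]))"
    unfolding aff by (simp add: hull_inc)
  have "insert a (set xs) \<in> vertex_sets M" "insert b (set xs) \<in> vertex_sets M"
    "insert a (set xs) \<inter> insert b (set xs) = set xs"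
    using a b xs(2) by (auto simp: ordered_simplices_iff affine_frame_def)
  then show "convex hull (insert a (set xs)) \<inter> convex hull (insert b (set xs)) \<subseteq> convex hull (set xs)"
    using vertex_sets_Int[OF M, of "insert a (set xs)" "insert b (set xs)"] by simp
qed

lemma relative_orientation_mult:
  fixes us vs ws :: "'a::euclidean_space list"
  assumes "affine_frame k us" "affine_frame k vs" "affine_frame k ws"
    and "affine hull (set us) = affine hull (set vs)" "affine hull (set vs) = affine hull (set ws)"
  shows "relative_orientation us ws = relative_orientation us vs * relative_orientation vs ws"
  using relative_orientation_trans[OF assms(1,2), of ws] assms(3-5)
    hull_subset[of "set vs" affine] hull_subset[of "set ws" affine]
  by (simp add: affine_frame_def)

section \<open>Transport of chains along a simplicial isomorphism\<close>

lemma ordered_simplices_length: "vs \<in> ordered_simplices K k \<Longrightarrow> length vs = Suc k"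
  by (simp add: ordered_simplices_def)

lemma ordered_simplices_permute:
  assumes "vs \<in> ordered_simplices K k" "p permutes {..<Suc k}"
  shows "permute_list p vs \<in> ordered_simplices K k"
  using assms by (auto simp: ordered_simplices_def)

lemma ordered_simplices_face:
  assumes K: "simplicial_complex K" and vs: "vs \<in> ordered_simplices K (Suc k)" and i: "i \<le> Suc k"
  shows "take i vs @ drop (Suc i) vs \<in> ordered_simplices K k"
proof -
  let ?us = "take i vs @ drop (Suc i) vs"
  have len: "length vs = Suc (Suc k)" and dist: "distinct vs"
    using vs by (auto simp: ordered_simplices_def)
  have "vs = take i vs @ vs ! i # drop (Suc i) vs"
    using len i by (intro id_take_nth_drop) simp
  then have "distinct (take i vs @ vs ! i # drop (Suc i) vs)"
    using dist by metis
  then have "distinct ?us"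
    by auto
  moreover have "length ?us = Suc k"
    using len i by simp
  moreover have "set ?us \<subseteq> set vs"
    using set_take_subset[of i vs] set_drop_subset[of "Suc i" vs] by auto
  then have "set ?us \<in> vertex_sets K"
    using vertex_sets_subset[OF K] vs ordered_simplices_iff by blast
  ultimately show ?thesis
    by (simp add: ordered_simplices_iff affine_frame_def vertex_sets_def)
qed

lemma oriented_simplex_map:
  assumes "inj_on f (set us \<union> set ws)"
  shows "oriented_simplex (map f us) (map f ws) = oriented_simplex us ws"
proof -
  have "permute_list p (map f us) = map f ws \<longleftrightarrow> permute_list p us = ws"
    if "p permutes {..<length us}" for p
    using that assms by (simp add: permute_list_map inj_on_map_eq_map)
  then show ?thesis
    by (auto simp: oriented_simplex_def intro!: sum.cong)
qed

text \<open>Each summand is supported on the orderings of a face, and faces belong to the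
  complex.\<close>

lemma boundary_eq_0:
  assumes "simplicial_complex K" "ws \<notin> ordered_simplices K k"
  shows "boundary K (Suc k) x ws = 0"
proof -
  have "oriented_simplex (take i vs @ drop (Suc i) vs) ws = 0"
    if "vs \<in> ordered_simplices K (Suc k)" "i \<le> Suc k" for vs i
  proof -
    have "take i vs @ drop (Suc i) vs \<in> ordered_simplices K k" (is "?us \<in> _")
      by (rule ordered_simplices_face[OF assms(1) that])
    then have "{p. p permutes {..<length ?us} \<and> permute_list p ?us = ws} = {}"
      using ordered_simplices_permute assms(2) ordered_simplices_length by fastforce
    then show ?thesis
      by (simp only: oriented_simplex_def sum.empty)
  qed
  then show ?thesis
    by (simp add: boundary_def linear_extension_def)
qed

lemma subdivision_map_eq_0:
  assumes "ws \<notin> ordered_simplices M k"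
  shows "subdivision_map N M k c ws = 0"
  using assms by (simp add: subdivision_map_def linear_extension_def subdivided_simplex_def)

text \<open>Expresses dimensions by numbers of vertices, which a simplicial isomorphism
  preserves.\<close>

lemma aff_dim_image_complex:
  assumes "simplicial_complex K"
  shows "aff_dim ` K = (\<lambda>V. int (card V) - 1) ` vertex_sets K"
proof -
  have "K = (hull) convex ` vertex_sets K"
    using vertex_setsE[OF assms] by (auto simp: vertex_sets_def)
  then have "aff_dim ` K = (\<lambda>V. aff_dim (convex hull V)) ` vertex_sets K"
    by (metis image_image)
  also have "\<dots> = (\<lambda>V. int (card V) - 1) ` vertex_sets K"
    by (intro image_cong) (auto simp: aff_dim_convex_hull aff_dim_vertex_set(1))
  finally show ?thesis .
qed

text \<open>Used twice below: for \<open>f\<close> from \<open>M\<close> to \<open>M'\<close> and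
  for the automorphism \<open>g\<close> of \<open>N\<close>.\<close>

locale simplicial_isomorphism =
  fixes K L :: "'a::euclidean_space set set" and f :: "'a \<Rightarrow> 'a"
  assumes complex: "simplicial_complex K" "simplicial_complex L"
    and iso: "simplicial_iso K L f"
begin

lemma inj: "inj_on f (\<Union>(vertex_sets K))"
  using iso by (simp add: simplicial_iso_def bij_betw_def)

lemma inj_on_vertex_set: "V \<in> vertex_sets K \<Longrightarrow> inj_on f V"
  using inj by (rule inj_on_subset) auto

lemma image_vertex_sets: "(`) f ` vertex_sets K = vertex_sets L"
  using iso by (simp add: simplicial_iso_def)

lemma complex_dim_eq: "complex_dim K = complex_dim L"
proof -
  have "aff_dim ` L = (\<lambda>V. int (card (f ` V)) - 1) ` vertex_sets K"
    by (simp add: aff_dim_image_complex complex image_vertex_sets[symmetric] image_image)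
  also have "\<dots> = aff_dim ` K"
    unfolding aff_dim_image_complex[OF complex(1)]
    by (intro image_cong) (auto simp: card_image inj_on_vertex_set)
  finally show ?thesis
    by (simp add: complex_dim_def)
qed

lemma map_ordered_simplices:
  assumes "vs \<in> ordered_simplices K k"
  shows "map f vs \<in> ordered_simplices L k"
proof -
  have "inj_on f (set vs)" "f ` set vs \<in> vertex_sets L"
    using assms inj_on_vertex_set image_vertex_sets by (auto simp: ordered_simplices_iff)
  then show ?thesis
    using assms by (simp add: ordered_simplices_iff affine_frame_def distinct_map vertex_sets_def)
qed

lemma bij_betw_ordered_simplices:
  "bij_betw (map f) (ordered_simplices K k) (ordered_simplices L k)"
proof -
  have "inj_on (map f) (ordered_simplices K k)"
    by (rule inj_on_mapI, rule inj_on_subset[OF inj]) (auto simp: ordered_simplices_iff)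
  moreover have "us \<in> map f ` ordered_simplices K k" if us: "us \<in> ordered_simplices L k" for us
  proof -
    let ?h = "inv_into (\<Union>(vertex_sets K)) f"
    obtain V where V: "V \<in> vertex_sets K" "set us = f ` V"
      using us image_vertex_sets by (metis imageE ordered_simplices_iff)
    have set: "set (map ?h us) = V"
      using V inv_into_image_cancel[OF inj, of V] by auto
    have "f (?h u) = u" if "u \<in> set us" for u
      using that V by (intro f_inv_into_f) auto
    then have "map f (map ?h us) = us"
      unfolding map_map by (intro map_idI) simp
    moreover have "distinct (map ?h us)"
      by (metis calculation distinct_map us affine_frame_def ordered_simplices_iff)
    then have "map ?h us \<in> ordered_simplices K k"
      using us V set by (simp add: ordered_simplices_iff affine_frame_def vertex_sets_def)
    ultimately show ?thesis
      by (metis imageI)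
  qed
  ultimately show ?thesis
    using map_ordered_simplices by (auto simp: bij_betw_def)
qed

text \<open>Pulling back avoids an inverse of \<open>f\<close>. Lists that are not ordered simplices
  of \<open>K\<close> get the value \<open>0\<close> required of a chain, since \<open>f\<close> is
  arbitrary off the vertices.\<close>

definition pull :: "nat \<Rightarrow> 'a chain \<Rightarrow> 'a chain" where
  "pull k x vs = (if vs \<in> ordered_simplices K k then x (map f vs) else 0)"

lemma pull_add: "pull k (\<lambda>vs. x vs + y vs) = (\<lambda>vs. pull k x vs + pull k y vs)"
  by (auto simp: pull_def)

text \<open>Serves the case distinction on zero subspaces in \<open>max_cosine\<close>.\<close>

lemma pull_eq_0_iff:
  assumes "\<And>us. us \<notin> ordered_simplices L k \<Longrightarrow> x us = 0"
  shows "pull k x = (\<lambda>_. 0) \<longleftrightarrow> x = (\<lambda>_. 0)"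
proof
  assume *: "pull k x = (\<lambda>_. 0)"
  show "x = (\<lambda>_. 0)"
  proof
    fix us
    show "x us = 0"
    proof (cases "us \<in> ordered_simplices L k")
      case True
      then obtain vs where "vs \<in> ordered_simplices K k" "us = map f vs"
        using bij_betw_ordered_simplices by (auto simp: bij_betw_def)
      then show ?thesis
        using fun_cong[OF *, of vs] by (simp add: pull_def)
    qed (use assms in auto)
  qed
qed (auto simp: pull_def)

lemma pull_chains_iff:
  assumes "\<And>us. us \<notin> ordered_simplices L k \<Longrightarrow> x us = 0"
  shows "pull k x \<in> chains K k \<longleftrightarrow> x \<in> chains L k"
proof -
  have perm: "pull k x (permute_list p vs) = x (permute_list p (map f vs))"
    if "vs \<in> ordered_simplices K k" "p permutes {..<Suc k}" for p vs
    using that by (simp add: pull_def ordered_simplices_permute permute_list_map ordered_simplices_length)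
  have "pull k x \<in> chains K k \<longleftrightarrow> (\<forall>vs\<in>ordered_simplices K k. \<forall>p. p permutes {..<Suc k} \<longrightarrow>
      x (permute_list p (map f vs)) = of_int (sign p) * x (map f vs))"
    by (simp add: chains_def perm) (simp add: pull_def)
  also have "\<dots> \<longleftrightarrow> (\<forall>us\<in>map f ` ordered_simplices K k. \<forall>p. p permutes {..<Suc k} \<longrightarrow>
      x (permute_list p us) = of_int (sign p) * x us)"
    by simp
  also have "\<dots> \<longleftrightarrow> x \<in> chains L k"
    unfolding bij_betw_imp_surj_on[OF bij_betw_ordered_simplices] using assms by (simp add: chains_def)
  finally show ?thesis .
qed

lemma pull_chains: "pull k ` chains L k = chains K k"
proof
  show "pull k ` chains L k \<subseteq> chains K k"
    using pull_chains_iff by (force simp: chains_def)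
  show "chains K k \<subseteq> pull k ` chains L k"
  proof
    fix y assume y: "y \<in> chains K k"
    \<comment> \<open>\<open>y\<close> is carried forward by the inverse of \<open>map f\<close> on
      ordered simplices.\<close>
    define x where "x us = (if us \<in> ordered_simplices L k
      then y (inv_into (ordered_simplices K k) (map f) us) else 0)" for us
    have "pull k x = y"
      using y map_ordered_simplices bij_betw_inv_into_left[OF bij_betw_ordered_simplices]
      by (auto simp: pull_def x_def chains_def)
    moreover have "x \<in> chains L k"
      using pull_chains_iff[of k x] y calculation by (simp add: x_def)
    ultimately show "y \<in> pull k ` chains L k"
      by blast
  qed
qed

lemma chain_inner_pull: "chain_inner K k (pull k x) (pull k y) = chain_inner L k x y"
proof -
  have "(\<Sum>vs\<in>ordered_simplices K k. pull k x vs * pull k y vs)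
      = (\<Sum>vs\<in>ordered_simplices K k. x (map f vs) * y (map f vs))"
    by (intro sum.cong) (auto simp: pull_def)
  also have "\<dots> = (\<Sum>us\<in>ordered_simplices L k. x us * y us)"
    by (rule sum.reindex_bij_betw[OF bij_betw_ordered_simplices])
  finally show ?thesis
    by (simp add: chain_inner_def)
qed

text \<open>A change of variables along \<open>map f\<close>. It reduces naturality of
  \<open>boundary\<close> and \<open>subdivision_map\<close> to their values on single
  simplices.\<close>

lemma linear_extension_pull:
  assumes "\<And>vs. vs \<in> ordered_simplices K k \<Longrightarrow> F (map f vs) ws' = G vs ws"
  shows "linear_extension L k F x ws' = linear_extension K k G (pull k x) ws"
proof -
  have "(\<Sum>us\<in>ordered_simplices L k. x us * F us ws')
      = (\<Sum>vs\<in>ordered_simplices K k. x (map f vs) * F (map f vs) ws')"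
    by (rule sum.reindex_bij_betw[OF bij_betw_ordered_simplices, symmetric])
  also have "\<dots> = (\<Sum>vs\<in>ordered_simplices K k. pull k x vs * G vs ws)"
    by (intro sum.cong) (auto simp: pull_def assms)
  finally show ?thesis
    by (simp add: linear_extension_def)
qed

text \<open>Deleting an entry commutes with \<open>map f\<close>, and by injectivity on vertices the
  same permutations carry a face to \<open>ws\<close> before and after applying
  \<open>f\<close>.\<close>

lemma boundary_pull: "boundary K (Suc k) (pull (Suc k) x) = pull k (boundary L (Suc k) x)"
proof
  fix ws
  show "boundary K (Suc k) (pull (Suc k) x) ws = pull k (boundary L (Suc k) x) ws"
  proof (cases "ws \<in> ordered_simplices K k")
    case True
    have "boundary L (Suc k) x (map f ws) = boundary K (Suc k) (pull (Suc k) x) ws"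
      unfolding boundary_def
    proof (rule linear_extension_pull)
      fix vs assume vs: "vs \<in> ordered_simplices K (Suc k)"
      have "oriented_simplex (take i (map f vs) @ drop (Suc i) (map f vs)) (map f ws)
          = oriented_simplex (take i vs @ drop (Suc i) vs) ws" for i
      proof -
        have "set (take i vs @ drop (Suc i) vs) \<union> set ws \<subseteq> \<Union>(vertex_sets K)"
          using vs True set_take_subset[of i vs] set_drop_subset[of "Suc i" vs]
          by (auto simp: ordered_simplices_iff)
        from oriented_simplex_map[OF inj_on_subset[OF inj this]] show ?thesis
          by (simp add: take_map drop_map)
      qed
      then show "(\<Sum>i\<le>Suc k. (- 1) ^ i *
            oriented_simplex (take i (map f vs) @ drop (Suc i) (map f vs)) (map f ws))
          = (\<Sum>i\<le>Suc k. (- 1) ^ i * oriented_simplex (take i vs @ drop (Suc i) vs) ws)"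
        by (simp only:)
    qed
    then show ?thesis
      using True by (simp add: pull_def)
  qed (simp add: pull_def boundary_eq_0[OF complex(1)])
qed

lemma orth_complement_pull: "pull k ` orth_complement L k X = orth_complement K k (pull k ` X)"
proof -
  have "orth_complement K k (pull k ` X) = {y \<in> pull k ` chains L k. \<forall>x\<in>X. chain_inner K k (pull k x) y = 0}"
    by (simp add: orth_complement_def pull_chains)
  also have "\<dots> = pull k ` {y \<in> chains L k. \<forall>x\<in>X. chain_inner L k x y = 0}"
    by (auto simp: chain_inner_pull)
  finally show ?thesis
    by (simp add: orth_complement_def)
qed

text \<open>\<open>pull\<close> preserves inner products, so the set of values whose greatest
  element is taken stays the same. The assumption ensures that zero subspaces correspond.\<close>

lemma max_cosine_pull:
  assumes "\<And>x us. x \<in> X \<union> Y \<Longrightarrow> us \<notin> ordered_simplices L k \<Longrightarrow> x us = 0"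
  shows "max_cosine K k (pull k ` X) (pull k ` Y) = max_cosine L k X Y"
proof -
  have "pull k z = (\<lambda>_. 0) \<longleftrightarrow> z = (\<lambda>_. 0)" if "z \<in> X \<union> Y" for z
    by (rule pull_eq_0_iff) (rule assms[OF that])
  then have zero: "pull k ` X \<subseteq> {\<lambda>_. 0} \<longleftrightarrow> X \<subseteq> {\<lambda>_. 0}" "pull k ` Y \<subseteq> {\<lambda>_. 0} \<longleftrightarrow> Y \<subseteq> {\<lambda>_. 0}"
    unfolding image_subset_iff by (simp_all add: subset_eq)
  show ?thesis
    unfolding max_cosine_def zero by (simp only: bex_simps(7) chain_inner_pull)
qed

end

section \<open>Isomorphisms of subdivisions\<close>

text \<open>Applied to \<open>pull\<close> and pointwise addition, for the sum of subspaces in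
  \<open>V_space\<close>.\<close>

lemma image_binop:
  assumes "\<And>x y. h (G x y) = G (h x) (h y)"
  shows "h ` {G x y | x y. x \<in> A \<and> y \<in> B} = {G x y | x y. x \<in> h ` A \<and> y \<in> h ` B}" (is "?l = ?r")
proof
  show "?l \<subseteq> ?r"
    using assms by blast
  show "?r \<subseteq> ?l"
  proof clarify
    fix x y assume "x \<in> A" "y \<in> B"
    then have "h (G x y) \<in> ?l"
      by blast
    then show "G (h x) (h y) \<in> ?l"
      by (simp only: assms)
  qed
qed

locale subdivision_isomorphism =
  fixes N M M' :: "'a::euclidean_space set set" and f g :: "'a \<Rightarrow> 'a"
  assumes sub: "subdivision N M" "subdivision N M'"
    and iso_f: "simplicial_iso M M' f" and iso_g: "simplicial_iso N N g"
    and compat: "\<And>V W. \<lbrakk>V \<in> vertex_sets M; W \<in> vertex_sets N\<rbrakk> \<Longrightarrow>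
      convex hull V \<subseteq> convex hull W \<longleftrightarrow> convex hull (f ` V) \<subseteq> convex hull (g ` W)"
begin

sublocale F: simplicial_isomorphism M M' f
  using sub iso_f by unfold_locales (auto simp: subdivision_def)

sublocale G: simplicial_isomorphism N N g
  using sub iso_g by unfold_locales (auto simp: subdivision_def)

section \<open>Orientations of the simplices subdividing one simplex\<close>

definition subdivides :: "nat \<Rightarrow> 'a list \<Rightarrow> 'a list \<Rightarrow> bool" where
  "subdivides k vs ws \<longleftrightarrow> vs \<in> ordered_simplices N k \<and> ws \<in> ordered_simplices M k \<and>
     convex hull (set ws) \<subseteq> convex hull (set vs)"

text \<open>\<open>compat\<close> carries the containment over to the images, and injectivity
  preserves the number of vertices.\<close>

lemma subdivides_top:
  assumes "subdivides k vs ws"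
  shows "set ws \<in> top_simplices M k (set vs)" "set (map f ws) \<in> top_simplices M' k (set (map g vs))"
proof -
  have *: "vs \<in> ordered_simplices N k" "ws \<in> ordered_simplices M k" "map f ws \<in> ordered_simplices M' k"
    using assms F.map_ordered_simplices by (auto simp: subdivides_def)
  have "card (set us) = Suc k" if "us \<in> ordered_simplices K k" for us and K :: "'a set set"
    using that by (auto simp: ordered_simplices_def distinct_card)
  then show "set ws \<in> top_simplices M k (set vs)"
    "set (map f ws) \<in> top_simplices M' k (set (map g vs))"
    using assms * compat[of "set ws" "set vs"] *[THEN ordered_simplices_iff[THEN iffD1]]
    by (auto simp: top_simplices_def subdivides_def simp flip: set_map)
qed

lemma subdivides_affine_hull:
  assumes "subdivides k vs ws"
  shows "affine hull (set ws) = affine hull (set vs)"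
    and "affine hull (set (map f ws)) = affine hull (set (map g vs))"
proof -
  have *: "vs \<in> ordered_simplices N k" "map g vs \<in> ordered_simplices N k"
    using assms G.map_ordered_simplices by (auto simp: subdivides_def)
  have N: "set us \<in> vertex_sets N" "card (set us) = Suc k" if "us \<in> ordered_simplices N k" for us
    using that by (auto simp: ordered_simplices_iff affine_frame_def distinct_card)
  show "affine hull (set ws) = affine hull (set vs)"
    by (rule top_simplices_affine_hull[OF N[OF *(1)] subdivides_top(1)[OF assms]])
  show "affine hull (set (map f ws)) = affine hull (set (map g vs))"
    by (rule top_simplices_affine_hull[OF N[OF *(2)] subdivides_top(2)[OF assms]])
qed

lemma subdivides_frames:
  assumes "subdivides k vs ws"
  shows "affine_frame k vs" "affine_frame k ws" "affine_frame k (map g vs)" "affine_frame k (map f ws)"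
  using assms F.map_ordered_simplices G.map_ordered_simplices
  by (auto simp: subdivides_def ordered_simplices_iff)

text \<open>For simplices subdividing a common simplex both factors are signs, and the product is
  \<open>1\<close> exactly if \<open>f\<close> preserves whether the two orderings are
  compatible.\<close>

definition orientation_change :: "'a list \<Rightarrow> 'a list \<Rightarrow> real" where
  "orientation_change ws ws' = relative_orientation ws ws' * relative_orientation (map f ws) (map f ws')"

text \<open>\<open>f\<close> commutes with the permutation relating the two orderings, so both
  factors are the same sign.\<close>

lemma orientation_change_permute:
  assumes "ws \<in> ordered_simplices M k" "ws' \<in> ordered_simplices M k" "set ws = set ws'"
  shows "orientation_change ws ws' = 1"
proof -
  have fr: "affine_frame k ws" "affine_frame k ws'" "affine_frame k (map f ws)"
    using assms F.map_ordered_simplices by (auto simp: ordered_simplices_iff)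
  have "mset ws' = mset ws"
    using fr assms(3) by (auto simp: affine_frame_def set_eq_iff_mset_eq_distinct)
  then obtain p where p: "p permutes {..<length ws}" "permute_list p ws = ws'"
    by (rule mset_eq_permutation)
  have len: "length ws = Suc k"
    using fr by (simp add: affine_frame_def)
  have "relative_orientation (map f ws) (map f ws') = relative_orientation ws ws'"
    using relative_orientation_permute[OF fr(3,1), of p] p len by (simp add: permute_list_map)
  moreover have "relative_orientation ws ws' = 1 \<or> relative_orientation ws ws' = -1"
    using relative_orientation_sign[OF fr(1,2)] assms(3) by simp
  ultimately show ?thesis
    by (auto simp: orientation_change_def)
qed

lemma orientation_change_trans:
  assumes "subdivides k vs ws" "subdivides k vs ws'" "subdivides k vs ws''"
  shows "orientation_change ws ws'' = orientation_change ws ws' * orientation_change ws' ws''"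
proof -
  note fr = subdivides_frames[OF assms(1)] subdivides_frames[OF assms(2)] subdivides_frames[OF assms(3)]
  note ah = subdivides_affine_hull[OF assms(1)] subdivides_affine_hull[OF assms(2)]
    subdivides_affine_hull[OF assms(3)]
  have "relative_orientation ws ws'' = relative_orientation ws ws' * relative_orientation ws' ws''"
    "relative_orientation (map f ws) (map f ws'')
      = relative_orientation (map f ws) (map f ws') * relative_orientation (map f ws') (map f ws'')"
    by (intro relative_orientation_mult[of k] fr; simp only: ah)+
  then show ?thesis
    by (simp add: orientation_change_def)
qed

text \<open>Passing to the neighbour across a common facet reverses the orientation in \<open>M\<close> and
  in \<open>M'\<close>.\<close>

lemma orientation_change_adjacent:
  assumes ws: "subdivides k vs ws" "subdivides k vs ws'"
    and facet: "card (set ws \<inter> set ws') = k" "0 < k"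
  shows "orientation_change ws ws' = 1"
proof -
  have top: "set ws \<in> top_simplices M k (set vs)" "set ws' \<in> top_simplices M k (set vs)"
    using ws subdivides_top by blast+
  \<comment> \<open>Listing the common facet first gives orderings \<open>xs @ [a]\<close> and
    \<open>xs @ [b]\<close> that differ in the last entry only.\<close>
  obtain xs where xs: "set xs = set ws \<inter> set ws'" "distinct xs"
    using finite_distinct_list[of "set ws \<inter> set ws'"] by auto
  have card: "card (set ws) = Suc k" "card (set ws') = Suc k"
    using top by (auto simp: top_simplices_def)
  have "card (set ws - set ws') = 1" "card (set ws' - set ws) = 1"
    using card facet card_Diff_subset_Int[of "set ws" "set ws'"] card_Diff_subset_Int[of "set ws'" "set ws"]
    by (simp_all add: Int_commute)
  then obtain a b where "set ws - set ws' = {a}" "set ws' - set ws = {b}"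
    by (auto simp: card_1_singleton_iff)
  then have sets: "set (xs @ [a]) = set ws" "set (xs @ [b]) = set ws'" "a \<notin> set xs" "b \<notin> set xs" "a \<noteq> b"
    using xs(1) by auto
  have "xs \<noteq> []"
    using xs(1) facet by auto
  have len: "length xs = k"
    using xs facet by (simp add: distinct_card[symmetric])
  have ord: "ws \<in> ordered_simplices M k" "ws' \<in> ordered_simplices M k"
    using ws by (auto simp: subdivides_def)
  have ord': "xs @ [a] \<in> ordered_simplices M k" "xs @ [b] \<in> ordered_simplices M k"
    using ord sets(1,2) sets(3,4) xs(2) len by (auto simp: ordered_simplices_def simp del: set_append)
  have sub': "subdivides k vs (xs @ [a])" "subdivides k vs (xs @ [b])"
    using ws ord' sets(1,2) by (auto simp: subdivides_def simp del: set_append)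
  have "relative_orientation (xs @ [a]) (xs @ [b]) = -1"
    by (rule relative_orientation_adjacent_simplices[OF F.complex(1) \<open>xs \<noteq> []\<close> sets(5) ord'])
      (use subdivides_affine_hull(1)[OF sub'(1)] subdivides_affine_hull(1)[OF sub'(2)] in simp)
  \<comment> \<open>The images again share all vertices but one and span the same affine hull, so
    the sign is \<open>-1\<close> in \<open>M'\<close> as well.\<close>
  moreover have "relative_orientation (map f xs @ [f a]) (map f xs @ [f b]) = -1"
  proof (rule relative_orientation_adjacent_simplices[OF F.complex(2)])
    have "a \<in> \<Union>(vertex_sets M)" "b \<in> \<Union>(vertex_sets M)"
      using ord' by (auto simp: ordered_simplices_iff)
    then show "f a \<noteq> f b"
      using inj_onD[OF F.inj] sets(5) by blast
  qed (use \<open>xs \<noteq> []\<close> F.map_ordered_simplices[OF ord'(1)] F.map_ordered_simplices[OF ord'(2)]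
        subdivides_affine_hull(2)[OF sub'(1)] subdivides_affine_hull(2)[OF sub'(2)] in simp_all)
  ultimately have "orientation_change (xs @ [a]) (xs @ [b]) = 1"
    by (simp add: orientation_change_def)
  \<comment> \<open>Returning to the given orderings changes nothing.\<close>
  moreover have "orientation_change ws (xs @ [a]) = 1" "orientation_change (xs @ [b]) ws' = 1"
    using ord ord' sets(1,2) by (auto intro!: orientation_change_permute simp del: set_append)
  ultimately show ?thesis
    using orientation_change_trans[OF ws(1) sub'(1) ws(2)] orientation_change_trans[OF sub' ws(2)]
    by simp
qed

text \<open>Neighbours have orientation change \<open>1\<close>, and by multiplicativity this
  spreads along the strongly connected set of simplices subdividing \<open>vs\<close>.\<close>

lemma orientation_change_eq_1:
  assumes ws: "subdivides k vs ws" "subdivides k vs ws'"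
  shows "orientation_change ws ws' = 1"
proof -
  \<comment> \<open>Strong connectedness speaks of vertex sets, hence the quantification over all
    orderings of \<open>V\<close>.\<close>
  define P where "P V \<longleftrightarrow> (\<forall>us. subdivides k vs us \<and> set us = V \<longrightarrow> orientation_change ws us = 1)" for V
  have W: "set vs \<in> vertex_sets N" "card (set vs) = Suc k"
    using ws(1) by (auto simp: subdivides_def ordered_simplices_iff affine_frame_def distinct_card)
  have step: "P V" if "P U" "U \<in> top_simplices M k (set vs)" "card (U \<inter> V) = k" "0 < k" for U V
    unfolding P_def
  proof (intro allI impI)
    fix us assume us: "subdivides k vs us \<and> set us = V"
    have U: "U \<in> vertex_sets M" "card U = Suc k" "convex hull U \<subseteq> convex hull (set vs)"
      using that by (auto simp: top_simplices_def)
    obtain us' where us': "set us' = U" "distinct us'"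
      using finite_distinct_list[of U] U aff_dim_vertex_set(2) by blast
    have "length us' = Suc k"
      using us' U(2) by (simp add: distinct_card[symmetric])
    then have sub': "subdivides k vs us'"
      using us us' U by (auto simp: subdivides_def ordered_simplices_iff affine_frame_def vertex_sets_def)
    have "orientation_change us' us = 1"
      using that us us' sub' by (intro orientation_change_adjacent[of k vs]) auto
    moreover have "orientation_change ws us' = 1"
      using \<open>P U\<close> sub' us'(1) by (simp add: P_def)
    ultimately show "orientation_change ws us = 1"
      using orientation_change_trans[OF ws(1) sub'] us by simp
  qed
  have "P (set ws) \<longleftrightarrow> P (set ws')"
    by (rule top_simplices_strongly_connected[OF sub(1) W _ subdivides_top(1)[OF ws(1)] subdivides_top(1)[OF ws(2)]])
      (metis step Int_commute)
  moreover have "P (set ws)"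
    unfolding P_def using ws(1) orientation_change_permute[of ws k] by (auto simp: subdivides_def)
  ultimately show ?thesis
    using ws(2) by (auto simp: P_def)
qed

definition orientation_sign :: "'a list \<Rightarrow> 'a list \<Rightarrow> real" where
  "orientation_sign vs ws = relative_orientation vs ws * relative_orientation (map g vs) (map f ws)"

lemma orientation_sign_cases:
  assumes "subdivides k vs ws"
  shows "orientation_sign vs ws = 1 \<or> orientation_sign vs ws = -1"
  using relative_orientation_sign[of k vs ws] relative_orientation_sign[of k "map g vs" "map f ws"]
    subdivides_frames[OF assms] subdivides_affine_hull[OF assms]
  by (auto simp: orientation_sign_def)

text \<open>Passing from \<open>ws\<close> to \<open>ws'\<close> multiplies the sign by
  \<open>orientation_change ws ws'\<close>, which is \<open>1\<close>.\<close>

lemma orientation_sign_eq: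
  assumes "subdivides k vs ws" "subdivides k vs ws'"
  shows "orientation_sign vs ws = orientation_sign vs ws'"
proof -
  note fr = subdivides_frames[OF assms(1)] subdivides_frames[OF assms(2)]
  note ah = subdivides_affine_hull[OF assms(1)] subdivides_affine_hull[OF assms(2)]
  have "relative_orientation vs ws' = relative_orientation vs ws * relative_orientation ws ws'"
    "relative_orientation (map g vs) (map f ws')
      = relative_orientation (map g vs) (map f ws) * relative_orientation (map f ws) (map f ws')"
    by (intro relative_orientation_mult[of k] fr; simp only: ah)+
  then have "orientation_sign vs ws' = orientation_sign vs ws * orientation_change ws ws'"
    by (simp add: orientation_sign_def orientation_change_def)
  then show ?thesis
    using orientation_change_eq_1[OF assms] by simp
qed

text \<open>Reordering \<open>vs\<close> multiplies both factors by the same sign, since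
  \<open>g\<close> commutes with the permutation.\<close>

lemma orientation_sign_permute:
  assumes "subdivides k vs ws" "p permutes {..<Suc k}"
  shows "orientation_sign (permute_list p vs) ws = orientation_sign vs ws"
proof -
  let ?us = "permute_list p vs"
  note fr = subdivides_frames[OF assms(1)]
  note ah = subdivides_affine_hull[OF assms(1)]
  have p: "p permutes {..<length vs}"
    using assms(2) fr(1) by (simp add: affine_frame_def)
  have us: "affine_frame k ?us" "affine_frame k (map g ?us)" "set ?us = set vs"
    "map g ?us = permute_list p (map g vs)"
    using fr p by (simp_all add: affine_frame_def flip: permute_list_map)
  have *: "relative_orientation vs ws = relative_orientation vs ?us * relative_orientation ?us ws"
    "relative_orientation (map g vs) (map f ws)
      = relative_orientation (map g vs) (map g ?us) * relative_orientation (map g ?us) (map f ws)"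
    by (intro relative_orientation_mult[of k] fr us(1,2); simp only: ah[unfolded set_map] set_map us(3))+
  have "relative_orientation (map g vs) (map g ?us) = relative_orientation vs ?us"
    using relative_orientation_permute[OF fr(3,1) assms(2)] us(4) by simp
  moreover have "relative_orientation vs ?us = 1 \<or> relative_orientation vs ?us = -1"
    using relative_orientation_sign[OF fr(1) us(1)] us(3) by simp
  ultimately show ?thesis
    by (auto simp: orientation_sign_def *)
qed

text \<open>The common value of \<open>orientation_sign vs\<close> on the simplices subdividing
  \<open>vs\<close>. The default \<open>1\<close> keeps it a sign for every list, which makes
  \<open>twist\<close> an involution.\<close>

definition degree :: "nat \<Rightarrow> 'a list \<Rightarrow> real" where
  "degree k vs = (if \<exists>ws. subdivides k vs ws \<and> orientation_sign vs ws = -1 then -1 else 1)"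

lemma degree_eq:
  assumes "subdivides k vs ws"
  shows "degree k vs = orientation_sign vs ws"
proof -
  have "(\<exists>ws'. subdivides k vs ws' \<and> orientation_sign vs ws' = -1) \<longleftrightarrow> orientation_sign vs ws = -1"
    using orientation_sign_eq[OF assms] assms by metis
  then show ?thesis
    using orientation_sign_cases[OF assms] unfolding degree_def by auto
qed

lemma degree_permute:
  assumes "vs \<in> ordered_simplices N k" "p permutes {..<Suc k}"
  shows "degree k (permute_list p vs) = degree k vs"
proof -
  have "subdivides k (permute_list p vs) ws \<longleftrightarrow> subdivides k vs ws" for ws
    using assms ordered_simplices_permute[OF assms] ordered_simplices_length[OF assms(1)]
    by (simp add: subdivides_def)
  then show ?thesis
    using orientation_sign_permute[OF _ assms(2)] by (simp add: degree_def cong: conj_cong)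
qed

section \<open>Comparison of the two subdivision maps\<close>

definition twist :: "nat \<Rightarrow> 'a chain \<Rightarrow> 'a chain" where
  "twist k c = (\<lambda>vs. degree k vs * c vs)"

text \<open>\<open>degree\<close> does not depend on the ordering, so alternating functions stay
  alternating; being an involution, \<open>twist\<close> is onto.\<close>

lemma twist_chains: "twist k ` chains N k = chains N k"
proof -
  have "twist k c \<in> chains N k" if "c \<in> chains N k" for c
    using that by (auto simp: chains_def twist_def degree_permute)
  moreover have "twist k (twist k c) = c" for c
    by (auto simp: twist_def degree_def)
  ultimately show ?thesis
    by (metis image_eqI image_subsetI subsetI subset_antisym)
qed

text \<open>On subdividing simplices the two orientations differ by the factor
  \<open>orientation_sign vs ws\<close>, the degree; elsewhere \<open>compat\<close> makes both
  sides zero.\<close>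

lemma subdivided_simplex_map:
  assumes "vs \<in> ordered_simplices N k" "ws \<in> ordered_simplices M k"
  shows "subdivided_simplex M' k (map g vs) (map f ws) = degree k vs * subdivided_simplex M k vs ws"
proof (cases "convex hull (set ws) \<subseteq> convex hull (set vs)")
  case True
  then have s: "subdivides k vs ws"
    using assms by (simp add: subdivides_def)
  have "convex hull (set (map f ws)) \<subseteq> convex hull (set (map g vs))"
    using subdivides_top(2)[OF s] by (simp add: top_simplices_def)
  then have "subdivided_simplex M' k (map g vs) (map f ws) = relative_orientation (map g vs) (map f ws)"
    using F.map_ordered_simplices[OF assms(2)] by (simp add: subdivided_simplex_def)
  also have "\<dots> = orientation_sign vs ws * relative_orientation vs ws"
    using relative_orientation_sign[of k vs ws] subdivides_frames[OF s] subdivides_affine_hull[OF s]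
    by (auto simp: orientation_sign_def)
  finally show ?thesis
    using True assms degree_eq[OF s] by (simp add: subdivided_simplex_def)
next
  case False
  then show ?thesis
    using compat[of "set ws" "set vs"] assms by (simp add: subdivided_simplex_def ordered_simplices_iff)
qed

lemma pull_subdivision_map:
  "F.pull k (subdivision_map N M' k c) = subdivision_map N M k (twist k (G.pull k c))"
proof
  fix ws
  show "F.pull k (subdivision_map N M' k c) ws = subdivision_map N M k (twist k (G.pull k c)) ws"
  proof (cases "ws \<in> ordered_simplices M k")
    case True
    have "subdivision_map N M' k c (map f ws)
        = linear_extension N k (\<lambda>vs ws. degree k vs * subdivided_simplex M k vs ws) (G.pull k c) ws"
      unfolding subdivision_map_def
      by (rule G.linear_extension_pull) (rule subdivided_simplex_map[OF _ True])
    then show ?thesis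
      using True by (simp add: F.pull_def subdivision_map_def linear_extension_def twist_def mult_ac)
  qed (simp add: F.pull_def subdivision_map_eq_0)
qed

text \<open>The signs and the automorphism \<open>g\<close> only rearrange the chains of
  \<open>N\<close>, so the image of the subdivision map is unaffected.\<close>

lemma pull_subdivision_im: "F.pull k ` subdivision_im N M' k = subdivision_im N M k"
proof -
  have "F.pull k ` subdivision_im N M' k = subdivision_map N M k ` twist k ` G.pull k ` chains N k"
    by (simp add: subdivision_im_def image_image pull_subdivision_map)
  then show ?thesis
    by (simp add: G.pull_chains twist_chains subdivision_im_def)
qed

section \<open>Transport of \<open>V_space\<close> and of \<open>C_value\<close>\<close>

lemma pull_boundary_image:
  assumes "F.pull (Suc k) ` V = V'"
  shows "F.pull k ` boundary M' (Suc k) ` V = boundary M (Suc k) ` V'"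
  by (simp add: image_image F.boundary_pull flip: assms)

text \<open>Induction downward from the top dimension, which \<open>M\<close> and \<open>M'\<close>
  share; each operation in the recursion commutes with \<open>pull\<close>.\<close>

lemma pull_V_space: "F.pull k ` V_space N M' k = V_space N M k"
proof (induction "complex_dim M - k" arbitrary: k rule: less_induct)
  case less
  show ?case
  proof (cases "complex_dim M \<le> k")
    case True
    then show ?thesis
      by (simp add: V_space.simps[of N _ k] F.complex_dim_eq[symmetric] F.orth_complement_pull pull_subdivision_im)
  next
    case False
    let ?A' = "subdivision_im N M' k" and ?B' = "boundary M' (Suc k) ` V_space N M' (Suc k)"
    let ?A = "subdivision_im N M k" and ?B = "boundary M (Suc k) ` V_space N M (Suc k)"
    have "complex_dim M - Suc k < complex_dim M - k"
      using False by simp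
    from less[OF this] have B: "F.pull k ` ?B' = ?B"
      by (rule pull_boundary_image)
    from image_binop[of "F.pull k" "\<lambda>x y vs. x vs + y vs" ?A' ?B', OF F.pull_add]
    have "F.pull k ` {\<lambda>vs. x vs + y vs | x y. x \<in> ?A' \<and> y \<in> ?B'}
        = {\<lambda>vs. x vs + y vs | x y. x \<in> ?A \<and> y \<in> ?B}"
      by (simp only: pull_subdivision_im B)
    then show ?thesis
      using False
      by (simp only: V_space.simps[of N _ k] F.complex_dim_eq[symmetric] if_False F.orth_complement_pull)
  qed
qed

lemma C_value_eq: "C_value k N M' = C_value k N M"
proof -
  have "max_cosine M k (F.pull k ` subdivision_im N M' k)
      (F.pull k ` boundary M' (Suc k) ` V_space N M' (Suc k))
    = max_cosine M' k (subdivision_im N M' k) (boundary M' (Suc k) ` V_space N M' (Suc k))"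
    by (rule F.max_cosine_pull)
      (auto simp: subdivision_im_def subdivision_map_eq_0 boundary_eq_0[OF F.complex(2)])
  then show ?thesis
    by (simp add: C_value_def pull_subdivision_im pull_boundary_image[OF pull_V_space])
qed

end

theorem theorem3p4:
  fixes N :: "'a::euclidean_space set set" and k :: nat
  assumes "simplicial_complex N"
  shows "subdivision_invariant N (C_value k N)"
  unfolding subdivision_invariant_def
proof (intro allI impI)
  fix M M' :: "'a set set"
  assume asm: "subdivision N M \<and> subdivision N M' \<and> isomorphic_subdivisions N M M'"
  then obtain f g where "simplicial_iso M M' f" "simplicial_iso N N g"
    "\<forall>V\<in>vertex_sets M. \<forall>W\<in>vertex_sets N.
       convex hull V \<subseteq> convex hull W \<longleftrightarrow> convex hull (f ` V) \<subseteq> convex hull (g ` W)"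
    by (auto simp: isomorphic_subdivisions_def)
  with asm interpret subdivision_isomorphism N M M' f g
    by unfold_locales auto
  show "C_value k N M = C_value k N M'"
    by (rule C_value_eq[symmetric])
qed

end
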